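(* Let $B=\mathbb{F}_2$, $F=\mathbb{F}_{2^\ell}$ with $\ell>1$. Suppose $\mathcal{A}$ is a $d$-dimensional $B$-linear subspace of $F$, where either $d=\ell$, or $d<\ell$ with $(\ell-d+2)\mid\ell$. Let $n=2^d$. Then the repair bandwidth $b$ of any I/O-optimal linear repair scheme for ${\rm RS}(\mathcal{A},2^d-3)$ satisfies $$b\ \geq\ (n-1)(d-1)-2^{2d-\ell-1}+\lfloor 2^{3d-2\ell-4}\rfloor.$$
   Context: ${\rm Tr}_{F/B}$ is the trace from $F$ to $B$. For $\mathcal{A}=\{\alpha_1,\dots,\alpha_n\}\subseteq F$ (distinct elements) and $1\le k<n$, ${\rm RS}(\mathcal{A},k)=\{(f(\alpha_1),\dots,f(\alpha_n)): f\in F[x],\ \deg f\le k-1\}$; coordinate $i$ is called node $i$. When $\mathcal{A}$ is a $B$-linear subspace of $F$, ${\rm RS}(\mathcal{A},k)^\perp={\rm RS}(\mathcal{A},n-k)$. A linear repair scheme (over $B$) for node $i^*$ of ${\rm RS}(\mathcal{A},k)$ is a list of $\ell$ polynomials $g_1,\dots,g_\ell\in F[x]$ of degree less than $n-k$ such that $g_1(\alpha_{i^*}),\dots,g_\ell(\alpha_{i^*})$ are linearly independent over $B$. Given a basis $\mathcal{B}=\{\beta^{(1)},\dots,\beta^{(\ell)}\}$ of $F$ over $B$, for $i\in\{1,\dots,n\}$ let $W_i$ be the $\ell\times\ell$ matrix over $B$ whose $(j,s)$ entry is ${\rm Tr}_{F/B}(g_j(\alpha_i)\beta^{(s)})$.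 The I/O cost with respect to $\mathcal{B}$ is $\gamma_{I/O}=\sum_{i=1}^n{\rm nz}(W_i)-\ell=\sum_{i\ne i^*}{\rm nz}(W_i)$, where ${\rm nz}(W)$ is the number of nonzero columns of $W$; the repair bandwidth is $b=\sum_{i=1}^n{\rm rank}(W_i)-\ell=\sum_{i\ne i^*}{\rm rank}(W_i)$ (it does not depend on the basis). A linear repair scheme for (a node of) ${\rm RS}(\mathcal{A},2^d-3)$, with $\mathcal{A}$ a $d$-dimensional $\mathbb{F}_2$-subspace of $\mathbb{F}_{2^\ell}$ and $n=2^d$, is called I/O-optimal if its I/O cost with respect to some basis $\mathcal{B}$ of $F$ over $B$ equals $(n-1)\ell-(\ell-d+2)2^{d-1}$ (which is a lower bound for the I/O cost of every linear repair scheme of this code). *)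

theory Defs
  imports "HOL-Analysis.Cartesian_Space" "HOL-Library.Z2"
    "HOL-Computational_Algebra.Polynomial" "HOL-Number_Theory.Residues"
begin

section \<open>A finite field of characteristic two as a vector space over the two-element field\<close>

text \<open>
  The base field is the type \<open>bit\<close>, the extension field is a type \<open>'f\<close> of class
  \<open>finite_field\<close>; that \<open>'f\<close> has \<open>2 ^ l\<close> elements is an assumption of each statement.
  \<open>of_bit\<close> is the inclusion of the base field.
\<close>

definition bscale :: "bit \<Rightarrow> 'f::finite_field \<Rightarrow> 'f"
  where "bscale b x = of_bit b * x"

abbreviation bsubspace :: "'f::finite_field set \<Rightarrow> bool"
  where "bsubspace \<equiv> module.subspace bscale"

abbreviation bspan :: "'f::finite_field set \<Rightarrow> 'f set"
  where "bspan \<equiv> module.span bscale"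

abbreviation bdim :: "'f::finite_field set \<Rightarrow> nat"
  where "bdim \<equiv> vector_space.dim bscale"

definition bindep_family :: "('l \<Rightarrow> 'f::finite_field) \<Rightarrow> bool"
  where "bindep_family v \<longleftrightarrow> inj v \<and> \<not> module.dependent bscale (range v)"

definition bbasis :: "('l \<Rightarrow> 'f::finite_field) \<Rightarrow> bool"
  where "bbasis \<beta> \<longleftrightarrow> bindep_family \<beta> \<and> bspan (range \<beta>) = UNIV"

text \<open>
  The sum of the conjugates \<open>x ^ (2 ^ i)\<close>, read back as an element of the base field;
  lemma \<open>of_bit_btrace\<close> below shows that the description is proper.
\<close>

definition btrace :: "'f::finite_field \<Rightarrow> bit"
  where "btrace x = (THE b. of_bit b = (\<Sum>i<bdim (UNIV :: 'f set). x ^ (2 ^ i)))"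

lemma CHAR_eq_2:
  assumes "CARD('f::finite_field) = 2 ^ l"
  shows "CHAR('f) = 2"
proof -
  have "prime CHAR('f)"
    by (rule prime_CHAR_semidom[OF finite_imp_CHAR_pos]) simp
  moreover have "CHAR('f) dvd 2 ^ l"
    using CHAR_dvd_CARD[where 'a = 'f] assms by simp
  ultimately show ?thesis
    by (metis prime_dvd_power primes_dvd_imp_eq two_is_prime_nat)
qed

lemma two_eq_0:
  assumes "CARD('f::finite_field) = 2 ^ l"
  shows "(1 :: 'f) + 1 = 0"
proof -
  have "(of_nat CHAR('f) :: 'f) = 0"
    by (rule of_nat_CHAR)
  then show ?thesis
    by (simp add: CHAR_eq_2[OF assms])
qed

lemma vector_space_bscale:
  assumes "CARD('f::finite_field) = 2 ^ l"
  shows "vector_space (bscale :: bit \<Rightarrow> 'f \<Rightarrow> 'f)"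
proof
  fix a b :: bit and x y :: 'f
  have "x + x = x * (1 + 1)"
    by (simp only: distrib_left mult_1_right)
  then have "x + x = 0"
    by (simp add: two_eq_0[OF assms] del: one_add_one)
  then show "bscale (a + b) x = bscale a x + bscale b x"
    by (cases a; cases b) (simp_all add: bscale_def)
  show "bscale a (x + y) = bscale a x + bscale a y"
    by (simp add: bscale_def distrib_left)
  show "bscale a (bscale b x) = bscale (a * b) x"
    by (cases a; cases b) (simp_all add: bscale_def)
  show "bscale 1 x = x"
    by (simp add: bscale_def)
qed

lemma card_bspan:
  fixes S :: "'f::finite_field set"
  assumes "CARD('f) = 2 ^ l" and "\<not> module.dependent bscale S"
  shows "card (bspan S) = 2 ^ card S"
proof -
  interpret vector_space "bscale :: bit \<Rightarrow> 'f \<Rightarrow> 'f"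
    using assms(1) by (rule vector_space_bscale)
  have "finite S"
    by simp
  then show ?thesis
    using assms(2)
  proof (induction S)
    case (insert a S)
    have a: "a \<notin> span S" and S: "independent S"
      using insert.hyps insert.prems by (auto simp: independent_insert)
    have "x \<in> span (insert a S) \<longleftrightarrow> x \<in> span S \<or> x - a \<in> span S" for x
    proof -
      have "(\<exists>k. x - bscale k a \<in> span S) \<longleftrightarrow> x - bscale 0 a \<in> span S \<or> x - bscale 1 a \<in> span S"
        by (metis bit.exhaust)
      then show ?thesis
        by (simp add: span_insert)
    qed
    moreover have "x - a \<in> span S \<longleftrightarrow> x \<in> (\<lambda>x. x + a) ` span S" for x
      by (force intro: rev_image_eqI)
    ultimately have eq: "span (insert a S) = span S \<union> (\<lambda>x. x + a) ` span S"
      by blast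
    have disj: "span S \<inter> (\<lambda>x. x + a) ` span S = {}"
      using a by (auto simp: span_add_eq)
    have "card ((\<lambda>x. x + a) ` span S) = card (span S)"
      by (intro card_image) (simp add: inj_on_def)
    then show ?case
      using insert S by (simp add: eq card_Un_disjoint disj)
  qed simp
qed

lemma card_bsubspace:
  fixes V :: "'f::finite_field set"
  assumes "CARD('f) = 2 ^ l" and "bsubspace V"
  shows "card V = 2 ^ bdim V"
proof -
  interpret vector_space "bscale :: bit \<Rightarrow> 'f \<Rightarrow> 'f"
    using assms(1) by (rule vector_space_bscale)
  obtain S where "S \<subseteq> V" "independent S" "V \<subseteq> span S" "card S = dim V"
    using basis_exists by blast
  moreover from this have "span S = V"
    using assms(2) by (intro subset_antisym span_minimal)
  ultimately show ?thesis
    using card_bspan[OF assms(1)] by metis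
qed

lemma bdim_UNIV:
  assumes "CARD('f::finite_field) = 2 ^ l"
  shows "bdim (UNIV :: 'f set) = l"
proof -
  interpret vector_space "bscale :: bit \<Rightarrow> 'f \<Rightarrow> 'f"
    using assms by (rule vector_space_bscale)
  show ?thesis
    using card_bsubspace[OF assms subspace_UNIV] assms by simp
qed

lemma of_bit_btrace:
  fixes x :: "'f::finite_field"
  assumes "CARD('f) = 2 ^ l"
  shows "of_bit (btrace x) = (\<Sum>i<l. x ^ (2 ^ i))"
proof -
  let ?s = "\<Sum>i<l. x ^ (2 ^ i)"
  have "?s ^ 2 = (\<Sum>i<l. (x ^ (2 ^ i)) ^ 2)"
    by (rule freshmans_dream_sum) (simp_all add: CHAR_eq_2[OF assms])
  also have "\<dots> = (\<Sum>i<l. x ^ (2 ^ Suc i))"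
    by (simp only: power_Suc2 power_mult)
  also have "\<dots> = ?s"
  proof -
    have "x ^ 2 ^ l = x"
      using finite_field_power_card_eq_same[of x] assms by simp
    then show ?thesis
      using sum.lessThan_Suc_shift[of "\<lambda>i. x ^ (2 ^ i)" l] by simp
  qed
  finally have "?s * (?s - 1) = 0"
    by (simp add: power2_eq_square right_diff_distrib)
  then have "?s = 0 \<or> ?s = 1"
    by simp
  then have "\<exists>b. of_bit b = ?s"
  proof
    assume "?s = 0"
    then show ?thesis by (intro exI[of _ 0]) simp
  next
    assume "?s = 1"
    then show ?thesis by (intro exI[of _ 1]) simp
  qed
  moreover have "b = c" if "of_bit b = ?s" "of_bit c = ?s" for b c
    using that by (cases b; cases c) auto
  ultimately have "\<exists>!b. of_bit b = ?s"
    by blast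
  from theI'[OF this] show ?thesis
    by (simp add: btrace_def bdim_UNIV[OF assms])
qed


section \<open>Linear repair schemes\<close>

text \<open>
  A node of \<open>RS(A, k)\<close> is identified with its evaluation point in \<open>A\<close>, so \<open>n = card A\<close>.
  The \<open>l\<close> polynomials of a scheme, and the \<open>l\<close> vectors of a basis, are indexed by a finite
  type \<open>'l\<close> with \<open>l = CARD('l)\<close>.
\<close>

definition linear_repair_scheme ::
    "'f::finite_field set \<Rightarrow> nat \<Rightarrow> 'f \<Rightarrow> ('l::finite \<Rightarrow> 'f poly) \<Rightarrow> bool"
  where "linear_repair_scheme A k \<alpha> g \<longleftrightarrow>
    \<alpha> \<in> A \<and> (\<forall>j. degree (g j) < card A - k) \<and> bindep_family (\<lambda>j. poly (g j) \<alpha>)"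

definition repair_matrix ::
    "('l::finite \<Rightarrow> 'f::finite_field poly) \<Rightarrow> ('l \<Rightarrow> 'f) \<Rightarrow> 'f \<Rightarrow> bit ^ 'l ^ 'l"
  where "repair_matrix g \<beta> \<alpha> = (\<chi> j s. btrace (poly (g j) \<alpha> * \<beta> s))"

definition nz :: "'a::zero ^ 'c ^ 'r \<Rightarrow> nat"
  where "nz W = card {s. column s W \<noteq> 0}"

text \<open>
  The matrix at the failed node is invertible, so it contributes \<open>CARD('l)\<close> to either sum below;
  subtracting \<open>CARD('l)\<close> leaves the contribution of the other nodes.
\<close>

definition io_cost ::
    "'f::finite_field set \<Rightarrow> ('l::finite \<Rightarrow> 'f poly) \<Rightarrow> ('l \<Rightarrow> 'f) \<Rightarrow> int"
  where "io_cost A g \<beta> = (\<Sum>\<alpha>\<in>A. int (nz (repair_matrix g \<beta> \<alpha>))) - int CARD('l)"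

definition repair_bandwidth ::
    "'f::finite_field set \<Rightarrow> ('l::finite \<Rightarrow> 'f poly) \<Rightarrow> ('l \<Rightarrow> 'f) \<Rightarrow> int"
  where "repair_bandwidth A g \<beta> = (\<Sum>\<alpha>\<in>A. int (rank (repair_matrix g \<beta> \<alpha>))) - int CARD('l)"

text \<open>
  I/O-optimality of a scheme for a node of \<open>RS(A, 2 ^ d - 3)\<close>, where \<open>A\<close> is a subspace of
  dimension \<open>d\<close>.  It is only meant for \<open>2 \<le> d \<le> l\<close>, where no natural-number subtraction truncates.
\<close>

definition io_optimal_scheme ::
    "'f::finite_field set \<Rightarrow> 'f \<Rightarrow> ('l::finite \<Rightarrow> 'f poly) \<Rightarrow> bool"
  where "io_optimal_scheme A \<alpha> g \<longleftrightarrow>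
    linear_repair_scheme A (2 ^ bdim A - 3) \<alpha> g \<and>
    (\<exists>\<beta>. bbasis \<beta> \<and>
      io_cost A g \<beta> = (2 ^ bdim A - 1) * int CARD('l)
        - (int CARD('l) - int (bdim A) + 2) * 2 ^ (bdim A - 1))"

end

theory Submission
  imports Defs
begin

text \<open>
  Combine the polynomials of the scheme to \<open>P u\<close> for \<open>u\<close> in \<open>bit ^ 'l\<close>.  The node \<open>x\<close> transmits
  \<open>rank W\<close> bits exactly when \<open>x\<close> is a root of \<open>2 ^ (l - rank W)\<close> of the \<open>P u\<close>.  For \<open>u \<noteq> 0\<close> the polynomial
  \<open>P u\<close> is a nonzero quadratic, so it has at most two roots, and none if it is constant.  Counting the pairs
  \<open>(u, x)\<close> with \<open>P u\<close> vanishing at \<open>x\<close>, and convexity of the exponential, bound the bandwidth from below in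
  terms of the number of constant \<open>P u\<close>.

  Put \<open>m = l - d + 2\<close>.  I/O-optimality is used to find at least \<open>2 ^ (l - 2 * m)\<close> constants.  In
  characteristic two \<open>x \<mapsto> Tr (P u x * \<beta> s)\<close> is affine on \<open>A\<close>.  Hence the set \<open>Z s\<close> of nodes whose column \<open>s\<close> is
  zero is empty or has codimension some \<open>r s \<ge> 1\<close>, and then the \<open>u\<close> with \<open>Tr (P u x * \<beta> s) = 0\<close> on all of \<open>A\<close>
  form a subspace \<open>K s\<close> of the same codimension \<open>r s\<close>.  Any \<open>m\<close> of the \<open>K s\<close> intersect in constants only, so
  the number of nonempty \<open>Z s\<close> is at most the sum of the corresponding \<open>m\<close> values \<open>r s\<close>.  As the sizes of the
  \<open>Z s\<close> add up to \<open>m * 2 ^ (d - 1)\<close>, this forces \<open>r s \<le> 2\<close> for \<open>m\<close> values of \<open>s\<close>, and the intersection of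
  their \<open>K s\<close> has codimension at most \<open>2 * m\<close>.

  For \<open>d = 2\<close> the bound follows instead from \<open>b \<ge> l\<close>, since no nonzero \<open>P u\<close> vanishes at three nodes.
\<close>

section \<open>Finite abelian groups and pairings\<close>

text \<open>Keeps arithmetic in the base field in ring form instead of turning it into bitwise
  operations.\<close>

declare add_bit_eq_xor [simp del] mult_bit_eq_and [simp del] minus_bit_def [simp del]

lemma UNIV_bit: "(UNIV :: bit set) = {0, 1}"
  by (auto intro: bit.exhaust)

instance bit :: finite
  by standard (simp add: UNIV_bit)

lemma CARD_bit: "CARD(bit) = 2"
  unfolding UNIV_bit by simp

text \<open>One notion that serves subsets of the field, of \<open>bit ^ 'l\<close> and of products
  alike. In a field with \<open>2 ^ l\<close> elements it singles out exactly the subspaces over the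
  base field, see \<open>finite_subgroup_bsubspace\<close>.\<close>

definition finite_subgroup :: "'a::ab_group_add set \<Rightarrow> bool"
  where "finite_subgroup G \<longleftrightarrow> finite G \<and> 0 \<in> G \<and> (\<forall>x\<in>G. \<forall>y\<in>G. x - y \<in> G)"

definition additive_on :: "'a::ab_group_add set \<Rightarrow> ('a \<Rightarrow> 'b::ab_group_add) \<Rightarrow> bool"
  where "additive_on G f \<longleftrightarrow> (\<forall>x\<in>G. \<forall>y\<in>G. f (x + y) = f x + f y)"

lemma finite_subgroupD:
  assumes "finite_subgroup G"
  shows "finite G" "0 \<in> G" "x \<in> G \<Longrightarrow> y \<in> G \<Longrightarrow> x - y \<in> G"
    "x \<in> G \<Longrightarrow> y \<in> G \<Longrightarrow> x + y \<in> G"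
proof -
  show "finite G" "0 \<in> G" and diff: "x \<in> G \<Longrightarrow> y \<in> G \<Longrightarrow> x - y \<in> G" for x y
    using assms by (auto simp: finite_subgroup_def)
  from diff[of 0 y] diff[of x "- y"] \<open>0 \<in> G\<close> show "x \<in> G \<Longrightarrow> y \<in> G \<Longrightarrow> x + y \<in> G"
    by simp
qed

lemma additive_on_add: "additive_on G f \<Longrightarrow> x \<in> G \<Longrightarrow> y \<in> G \<Longrightarrow> f (x + y) = f x + f y"
  by (simp add: additive_on_def)

lemma additive_on_diff:
  assumes "finite_subgroup G" "additive_on G f" "x \<in> G" "y \<in> G"
  shows "f (x - y) = f x - f y"
  using additive_on_add[OF assms(2) finite_subgroupD(3)[OF assms(1,3,4)] assms(4)] by simp

lemma additive_on_0:
  assumes "finite_subgroup G" "additive_on G f"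
  shows "f 0 = 0"
  using additive_on_diff[OF assms finite_subgroupD(2)[OF assms(1)] finite_subgroupD(2)[OF assms(1)]] by simp

lemma finite_subgroup_kernel:
  assumes "finite_subgroup G" "\<And>i. i \<in> I \<Longrightarrow> additive_on G (f i)"
  shows "finite_subgroup {x \<in> G. \<forall>i\<in>I. f i x = 0}"
  using finite_subgroupD(1,2,3)[OF assms(1)] additive_on_0[OF assms(1) assms(2)]
    additive_on_diff[OF assms(1) assms(2)]
  unfolding finite_subgroup_def by auto

text \<open>Subtracting one point of a fibre injects that fibre into the kernel.\<close>

lemma card_le_kernel_image:
  assumes G: "finite_subgroup G" and f: "additive_on G f"
  shows "card G \<le> card {x \<in> G. f x = 0} * card (f ` G)"
proof -
  have fin: "finite G"
    using G by (rule finite_subgroupD)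
  have "card {x \<in> G. f x = y} \<le> card {x \<in> G. f x = 0}" if "y \<in> f ` G" for y
  proof -
    obtain a where a: "a \<in> G" "f a = y"
      using \<open>y \<in> f ` G\<close> by blast
    show ?thesis
    proof (rule card_inj_on_le[of "\<lambda>x. x - a"])
      show "inj_on (\<lambda>x. x - a) {x \<in> G. f x = y}"
        by (auto simp: inj_on_def)
      show "(\<lambda>x. x - a) ` {x \<in> G. f x = y} \<subseteq> {x \<in> G. f x = 0}"
        using a additive_on_diff[OF G f] finite_subgroupD(3)[OF G] by auto
    qed (use fin in auto)
  qed
  then have "(\<Sum>y\<in>f ` G. card {x \<in> G. f x = y}) \<le> (\<Sum>y\<in>f ` G. card {x \<in> G. f x = 0})"
    by (rule sum_mono)
  moreover have "card G = (\<Sum>y\<in>f ` G. card {x \<in> G. f x = y})"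
    using sum.image_gen[OF fin, of "\<lambda>_. 1::nat" f] by simp
  ultimately show ?thesis
    by (simp add: mult.commute)
qed

text \<open>The difference map on \<open>K \<times> L\<close> has values in \<open>U\<close>, and
  its kernel is the diagonal copy of \<open>K \<inter> L\<close>.\<close>

lemma card_mult_le_card_Int:
  assumes U: "finite U" and K: "finite_subgroup K" "K \<subseteq> U" and L: "finite_subgroup L" "L \<subseteq> U"
    and diff: "\<And>x y. x \<in> U \<Longrightarrow> y \<in> U \<Longrightarrow> x - y \<in> U"
  shows "card K * card L \<le> card (K \<inter> L) * card U"
proof -
  let ?f = "\<lambda>(x, y). x - y"
  have KL: "finite_subgroup (K \<times> L)"
    using K(1) L(1) by (auto simp: finite_subgroup_def zero_prod_def)
  have "additive_on (K \<times> L) ?f"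
    by (auto simp: additive_on_def)
  from card_le_kernel_image[OF KL this]
  have "card (K \<times> L) \<le> card {p \<in> K \<times> L. ?f p = 0} * card (?f ` (K \<times> L))" .
  also have "{p \<in> K \<times> L. ?f p = 0} = (\<lambda>x. (x, x)) ` (K \<inter> L)"
    by auto
  also have "card \<dots> = card (K \<inter> L)"
    by (intro card_image) (auto simp: inj_on_def)
  also have "card (?f ` (K \<times> L)) \<le> card U"
    using U K L diff by (intro card_mono) auto
  finally show ?thesis
    by (simp add: card_cartesian_product)
qed

text \<open>Codimension is subadditive under intersection; \<open>c i\<close> bounds the codimension
  of \<open>K i\<close> in \<open>U\<close>.\<close>

lemma card_le_card_INT:
  assumes U: "finite_subgroup U" and "finite I"
    and "\<And>i. i \<in> I \<Longrightarrow> finite_subgroup (K i) \<and> K i \<subseteq> U \<and> card U \<le> card (K i) * 2 ^ c i"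
  shows "card U \<le> card {x \<in> U. \<forall>i\<in>I. x \<in> K i} * 2 ^ (\<Sum>i\<in>I. c i)"
  using assms(2,3)
proof (induction I)
  case (insert j I)
  let ?L = "{x \<in> U. \<forall>i\<in>I. x \<in> K i}"
  have IH: "card U \<le> card ?L * 2 ^ (\<Sum>i\<in>I. c i)"
    using insert by simp
  have j: "finite_subgroup (K j)" "K j \<subseteq> U" "card U \<le> card (K j) * 2 ^ c j"
    using insert.prems by auto
  have "finite_subgroup ?L"
    using U insert.prems by (auto simp: finite_subgroup_def)
  from card_mult_le_card_Int[OF finite_subgroupD(1)[OF U] j(1,2) this _ finite_subgroupD(3)[OF U]]
  have "card (K j) * card ?L \<le> card (K j \<inter> ?L) * card U"
    by auto
  also have "K j \<inter> ?L = {x \<in> U. \<forall>i\<in>insert j I. x \<in> K i}" (is "_ = ?M")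
    using j by auto
  finally have *: "card (K j) * card ?L \<le> card ?M * card U" .
  have "card U * card U \<le> (card (K j) * 2 ^ c j) * (card ?L * 2 ^ (\<Sum>i\<in>I. c i))"
    using IH j(3) by (rule mult_le_mono[rotated])
  also have "\<dots> = (card (K j) * card ?L) * 2 ^ (\<Sum>i\<in>insert j I. c i)"
    using insert.hyps by (simp add: power_add mult_ac)
  also have "\<dots> \<le> (card ?M * card U) * 2 ^ (\<Sum>i\<in>insert j I. c i)"
    using * by (rule mult_right_mono) simp
  finally have "card U * card U \<le> (card ?M * 2 ^ (\<Sum>i\<in>insert j I. c i)) * card U"
    by (simp add: mult_ac)
  moreover have "card U > 0"
    using finite_subgroupD(1,2)[OF U] by (auto simp: card_gt_0_iff)
  ultimately show ?case
    by simp
qed simp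

section \<open>Sign characters and annihilators of a pairing\<close>

definition bit_sign :: "bit \<Rightarrow> int"
  where "bit_sign b = (if b = 0 then 1 else - 1)"

text \<open>Orthogonality of characters: translation by a point \<open>a\<close> with
  \<open>f a = 1\<close> flips every sign, so the sum equals its own negative.\<close>

lemma sum_bit_sign:
  assumes G: "finite_subgroup G" and f: "additive_on G f"
  shows "(\<Sum>x\<in>G. bit_sign (f x)) = (if \<forall>x\<in>G. f x = 0 then int (card G) else 0)"
proof (cases "\<forall>x\<in>G. f x = 0")
  case False
  then obtain a where a: "a \<in> G" "f a = 1"
    by auto
  have "inj_on (\<lambda>x. x + a) G"
    by (auto simp: inj_on_def)
  moreover have "(\<lambda>x. x + a) ` G = G"
    using calculation finite_subgroupD[OF G] a by (intro endo_inj_surj) auto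
  ultimately have "(\<Sum>x\<in>G. bit_sign (f x)) = (\<Sum>x\<in>G. bit_sign (f (x + a)))"
    by (metis (no_types, lifting) sum.reindex_cong)
  also have "\<dots> = (\<Sum>x\<in>G. - bit_sign (f x))"
  proof (rule sum.cong)
    fix x assume "x \<in> G"
    then have "f (x + a) = f x + 1"
      using a by (simp add: additive_on_add[OF f])
    then show "bit_sign (f (x + a)) = - bit_sign (f x)"
      by (cases "f x") (simp_all add: bit_sign_def)
  qed simp
  finally show ?thesis
    using False by (auto simp: sum_negf)
qed (simp add: bit_sign_def)

text \<open>The signs of the pairing are summed over \<open>G \<times> H\<close> in both orders; by
  orthogonality only the annihilating elements contribute.\<close>

lemma card_annihilator:
  assumes G: "finite_subgroup G" and H: "finite_subgroup H"
    and l: "\<And>y. y \<in> H \<Longrightarrow> additive_on G (\<lambda>x. f x y)"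
    and r: "\<And>x. x \<in> G \<Longrightarrow> additive_on H (\<lambda>y. f x y :: bit)"
  shows "card G * card {y \<in> H. \<forall>x\<in>G. f x y = 0} = card H * card {x \<in> G. \<forall>y\<in>H. f x y = 0}"
proof -
  have fin: "finite G" "finite H"
    using G H by (auto simp: finite_subgroupD)
  have "(\<Sum>y\<in>H. \<Sum>x\<in>G. bit_sign (f x y)) = (\<Sum>y\<in>H. if \<forall>x\<in>G. f x y = 0 then int (card G) else 0)"
    by (intro sum.cong sum_bit_sign G l) auto
  moreover have "(\<Sum>x\<in>G. \<Sum>y\<in>H. bit_sign (f x y)) = (\<Sum>x\<in>G. if \<forall>y\<in>H. f x y = 0 then int (card H) else 0)"
    by (intro sum.cong sum_bit_sign H r) auto
  moreover have "(\<Sum>y\<in>H. \<Sum>x\<in>G. bit_sign (f x y)) = (\<Sum>x\<in>G. \<Sum>y\<in>H. bit_sign (f x y))"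
    by (rule sum.swap)
  ultimately have "int (card G) * card {y \<in> H. \<forall>x\<in>G. f x y = 0} =
      int (card H) * card {x \<in> G. \<forall>y\<in>H. f x y = 0}"
    using fin by (simp add: sum.If_cases Int_def conj_commute mult.commute)
  then show ?thesis
    by (simp flip: of_nat_mult)
qed

section \<open>The trace form\<close>

lemma char2_add_self:
  assumes "CARD('f::finite_field) = 2 ^ l"
  shows "(x :: 'f) + x = 0"
  using two_eq_0[OF assms] distrib_left[of x 1 1] by (simp del: one_add_one)

lemma of_bit_add:
  assumes "CARD('f::finite_field) = 2 ^ l"
  shows "(of_bit (a + b) :: 'f) = of_bit a + of_bit b"
  using two_eq_0[OF assms] by (cases a; cases b) (simp_all del: one_add_one)

lemma of_bit_inject: "(of_bit a :: 'f::finite_field) = of_bit b \<longleftrightarrow> a = b"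
  by (cases a; cases b) simp_all

lemma btrace_add:
  fixes x y :: "'f::finite_field"
  assumes "CARD('f) = 2 ^ l"
  shows "btrace (x + y) = btrace x + btrace y"
proof -
  have "(x + y) ^ 2 ^ i = x ^ 2 ^ i + y ^ 2 ^ i" for i
    by (rule freshmans_dream') (simp_all add: CHAR_eq_2[OF assms])
  then have "(of_bit (btrace (x + y)) :: 'f) = of_bit (btrace x + btrace y)"
    by (simp only: of_bit_btrace[OF assms] of_bit_add[OF assms] sum.distrib)
  then show ?thesis
    by (simp only: of_bit_inject)
qed

lemma btrace_0:
  assumes "CARD('f::finite_field) = 2 ^ l"
  shows "btrace (0 :: 'f) = 0"
  using btrace_add[OF assms, of 0 0] by simp

lemma btrace_sum:
  assumes "CARD('f::finite_field) = 2 ^ l"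
  shows "btrace (\<Sum>j\<in>S. h j :: 'f) = (\<Sum>j\<in>S. btrace (h j))"
  by (induction S rule: infinite_finite_induct)
    (simp_all add: btrace_add[OF assms] btrace_0[OF assms])

text \<open>The trace of a square is the square of the trace, and elements of the base field are
  their own squares.\<close>

lemma btrace_square:
  fixes x :: "'f::finite_field"
  assumes "CARD('f) = 2 ^ l"
  shows "btrace (x ^ 2) = btrace x"
proof -
  have "(\<Sum>i<l. (x ^ 2 ^ i)) ^ 2 = (\<Sum>i<l. (x ^ 2 ^ i) ^ 2)"
    by (rule freshmans_dream_sum) (simp_all add: CHAR_eq_2[OF assms])
  moreover have "(x ^ 2 ^ i) ^ 2 = (x ^ 2) ^ 2 ^ i" for i
    by (simp flip: power_mult add: mult.commute)
  ultimately have "(of_bit (btrace (x ^ 2)) :: 'f) = of_bit (btrace x) ^ 2"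
    by (simp only: of_bit_btrace[OF assms])
  also have "\<dots> = of_bit (btrace x)"
    by (cases "btrace x") simp_all
  finally show ?thesis
    by (simp only: of_bit_inject)
qed

text \<open>The trace is a nonzero polynomial function of degree less than the size of the field.\<close>

lemma btrace_nondegenerate:
  fixes x :: "'f::finite_field"
  assumes "CARD('f) = 2 ^ l" and "\<And>y. btrace (x * y) = 0"
  shows "x = 0"
proof (rule ccontr)
  assume x: "x \<noteq> 0"
  have "btrace z = 0" for z :: 'f
    using assms(2)[of "z / x"] x by simp
  then have zero: "(\<Sum>i<l. z ^ 2 ^ i) = 0" for z :: 'f
    using of_bit_btrace[OF assms(1), of z] by simp
  have l: "l > 0"
  proof (rule ccontr)
    assume "\<not> l > 0"
    then have "CARD('f) = 1"
      using assms(1) by simp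
    then have "(0 :: 'f) = 1"
      by (metis UNIV_I card_1_singletonE singletonD)
    then show False
      by simp
  qed
  define p :: "'f poly" where "p = (\<Sum>i<l. Polynomial.monom 1 (2 ^ i))"
  \<comment> \<open>Only the term with \<open>i = 0\<close> has degree one, so this coefficient
    witnesses that \<open>p\<close> is nonzero.\<close>
  have "poly.coeff p 1 = (\<Sum>i<l. if i = 0 then 1 else 0)"
    unfolding p_def coeff_sum by (rule sum.cong) auto
  then have "poly.coeff p 1 = 1"
    using l by simp
  then have p: "p \<noteq> 0"
    by auto
  have "degree p \<le> 2 ^ (l - 1)"
    unfolding p_def
    by (intro degree_sum_le) (auto intro!: order_trans[OF degree_monom_le] power_increasing)
  moreover have "{z. poly p z = 0} = UNIV"
    using zero by (simp add: p_def poly_sum poly_monom)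
  ultimately have "CARD('f) \<le> 2 ^ (l - 1)"
    using card_poly_roots_bound[OF p] by simp
  then show False
    using l assms(1) by (cases l) simp_all
qed

lemma finite_subgroup_bsubspace:
  fixes V :: "'f::finite_field set"
  assumes "CARD('f) = 2 ^ l"
  shows "finite_subgroup V \<longleftrightarrow> bsubspace V"
proof -
  interpret vector_space "bscale :: bit \<Rightarrow> 'f \<Rightarrow> 'f"
    using assms by (rule vector_space_bscale)
  have diff: "x - y = x + y" for x y :: 'f
    using char2_add_self[OF assms, of y] by (simp add: diff_eq_eq add.assoc)
  have "bscale c x \<in> V" if "0 \<in> V" "x \<in> V" for c x
    using that by (cases c) (simp_all add: bscale_def)
  then show ?thesis
    unfolding finite_subgroup_def subspace_def diff by auto
qed

lemma finite_subgroup_UNIV: "finite_subgroup (UNIV :: 'a::{ab_group_add, finite} set)"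
  by (simp add: finite_subgroup_def)

lemma card_finite_subgroup:
  fixes V :: "'f::finite_field set"
  assumes "CARD('f) = 2 ^ l" and "finite_subgroup V"
  shows "card V = 2 ^ bdim V"
  using assms by (simp add: card_bsubspace finite_subgroup_bsubspace)

lemma btrace_eq_0_span:
  fixes z :: "'f::finite_field"
  assumes "CARD('f) = 2 ^ l" and "\<And>y. y \<in> S \<Longrightarrow> btrace (z * y) = 0" and "y \<in> bspan S"
  shows "btrace (z * y) = 0"
proof -
  interpret vector_space "bscale :: bit \<Rightarrow> 'f \<Rightarrow> 'f"
    using assms(1) by (rule vector_space_bscale)
  have "finite_subgroup {y \<in> (UNIV::'f set). \<forall>z\<in>{z}. btrace (z * y) = 0}"
    by (intro finite_subgroup_kernel finite_subgroup_UNIV)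
      (simp add: additive_on_def distrib_left btrace_add[OF assms(1)])
  then have "subspace {y. btrace (z * y) = 0}"
    by (simp add: finite_subgroup_bsubspace[OF assms(1)])
  then have "span S \<subseteq> {y. btrace (z * y) = 0}"
    using assms(2) by (intro span_minimal) auto
  then show ?thesis
    using assms(3) by auto
qed

text \<open>This is \<open>card_annihilator\<close> with the whole field on one side; nondegeneracy
  leaves only 0 on the other.\<close>

lemma card_btrace_annihilator:
  fixes H :: "'f::finite_field set"
  assumes "CARD('f) = 2 ^ l" and "finite_subgroup H"
  shows "card H * card {x. \<forall>y\<in>H. btrace (x * y) = 0} = 2 ^ l"
proof -
  have "CARD('f) * card {y \<in> H. \<forall>x\<in>UNIV. btrace (x * y) = 0} =
      card H * card {x \<in> UNIV. \<forall>y\<in>H. btrace (x * y) = 0}"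
    by (rule card_annihilator[OF finite_subgroup_UNIV assms(2)])
      (simp_all add: additive_on_def distrib_left distrib_right btrace_add[OF assms(1)])
  moreover have "{y \<in> H. \<forall>x\<in>UNIV. btrace (x * y) = 0} = {0}"
    using btrace_nondegenerate[OF assms(1)] btrace_0[OF assms(1)] finite_subgroupD(2)[OF assms(2)]
    by (auto simp: mult.commute)
  ultimately show ?thesis
    by (simp add: assms(1))
qed

section \<open>Combinations of the polynomials of a repair scheme\<close>

text \<open>These are the \<open>P u\<close> of the overview.\<close>

definition comb_poly :: "('l::finite \<Rightarrow> 'f::finite_field poly) \<Rightarrow> bit ^ 'l \<Rightarrow> 'f poly"
  where "comb_poly g u = (\<Sum>j\<in>UNIV. Polynomial.smult (of_bit (u $ j)) (g j))"

lemma comb_poly_add: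
  assumes "CARD('f::finite_field) = 2 ^ l"
  shows "comb_poly (g :: _ \<Rightarrow> 'f poly) (u + v) = comb_poly g u + comb_poly g v"
  by (simp only: comb_poly_def vector_add_component of_bit_add[OF assms] smult_add_left sum.distrib)

lemma poly_comb_poly: "poly (comb_poly g u) x = (\<Sum>j\<in>UNIV. of_bit (u $ j) * poly (g j) x)"
  by (simp only: comb_poly_def poly_sum poly_smult)

lemma btrace_poly_comb_poly:
  assumes "CARD('f::finite_field) = 2 ^ l"
  shows "btrace (poly (comb_poly g u) x * (y :: 'f)) = (\<Sum>j\<in>UNIV. u $ j * btrace (poly (g j) x * y))"
proof -
  have "btrace (poly (comb_poly g u) x * y) = (\<Sum>j\<in>UNIV. btrace (of_bit (u $ j) * poly (g j) x * y))"
    unfolding poly_comb_poly sum_distrib_right by (rule btrace_sum[OF assms])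
  also have "\<dots> = (\<Sum>j\<in>UNIV. u $ j * btrace (poly (g j) x * y))"
  proof (rule sum.cong)
    show "btrace (of_bit (u $ j) * poly (g j) x * y) = u $ j * btrace (poly (g j) x * y)" for j
      by (cases "u $ j") (simp_all add: btrace_0[OF assms])
  qed simp
  finally show ?thesis .
qed

lemma comb_poly_eq_0:
  fixes g :: "'l::finite \<Rightarrow> 'f::finite_field poly"
  assumes "CARD('f) = 2 ^ l" and "bindep_family (\<lambda>j. poly (g j) \<alpha>)"
    and "poly (comb_poly g u) \<alpha> = 0"
  shows "u = 0"
proof -
  interpret vector_space "bscale :: bit \<Rightarrow> 'f \<Rightarrow> 'f"
    using assms(1) by (rule vector_space_bscale)
  let ?v = "\<lambda>j. poly (g j) \<alpha>"
  have inj: "inj ?v" and ind: "independent (range ?v)"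
    using assms(2) by (auto simp: bindep_family_def)
  \<comment> \<open>Independence speaks of the set of values, so the coefficients are carried over
    along the inverse of the injective family.\<close>
  have "(\<Sum>y\<in>range ?v. bscale (u $ inv_into UNIV ?v y) y) = (\<Sum>j\<in>UNIV. bscale (u $ j) (?v j))"
    using inj by (simp add: sum.reindex inv_into_f_f[OF inj])
  also have "\<dots> = 0"
    using assms(3) by (simp only: poly_comb_poly bscale_def)
  finally have "\<forall>y\<in>range ?v. u $ inv_into UNIV ?v y = 0"
    using ind by (auto simp: dependent_finite)
  then show ?thesis
    by (simp add: vec_eq_iff inv_into_f_f[OF inj])
qed

lemma degree_comb_poly:
  assumes "\<And>j. degree (g j) \<le> k"
  shows "degree (comb_poly g u) \<le> k"
  unfolding comb_poly_def
  by (intro degree_sum_le) (auto intro: order_trans[OF degree_smult_le] assms)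

section \<open>Root counts and matrix ranks\<close>

lemma CARD_bit_vec: "CARD(bit ^ 'l) = 2 ^ CARD('l::finite)"
  by (simp add: CARD_bit)

text \<open>The row space is spanned by \<open>rank M\<close> rows, each of which takes one of two
  coefficients.\<close>

lemma card_span_rows_le: "card (vec.span (rows (M :: bit ^ 'n ^ 'm))) \<le> 2 ^ rank M"
proof -
  obtain S where S: "S \<subseteq> rows M" "rows M \<subseteq> vec.span S" "card S = vec.dim (rows M)"
    using vec.basis_exists by metis
  have fin: "finite S"
    by simp
  have "vec.span (rows M) \<subseteq> vec.span S"
    using S(2) by (rule vec.span_minimal) simp
  also have "\<dots> \<subseteq> (\<lambda>c. \<Sum>v\<in>S. c v *s v) ` (S \<rightarrow>\<^sub>E UNIV)"
  proof
    fix x assume "x \<in> vec.span S"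
    then obtain c where "x = (\<Sum>v\<in>S. c v *s v)"
      using vec.span_finite[OF fin] by auto
    then have "x = (\<Sum>v\<in>S. restrict c S v *s v)"
      by (simp cong: sum.cong)
    then show "x \<in> (\<lambda>c. \<Sum>v\<in>S. c v *s v) ` (S \<rightarrow>\<^sub>E UNIV)"
      by (intro image_eqI[where x = "restrict c S"]) simp_all
  qed
  finally have "card (vec.span (rows M)) \<le> card ((\<lambda>c. \<Sum>v\<in>S. c v *s v) ` (S \<rightarrow>\<^sub>E (UNIV :: bit set)))"
    by (intro card_mono) auto
  also have "\<dots> \<le> card (S \<rightarrow>\<^sub>E (UNIV :: bit set))"
    by (intro card_image_le finite_PiE) auto
  also have "\<dots> = 2 ^ rank M"
    using S(3) by (simp add: card_PiE CARD_bit row_rank_def_gen)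
  finally show ?thesis .
qed

text \<open>Kernel and image of the map that combines the rows of the matrix with coefficients
  \<open>u\<close>: the image lies in the row space, and in the kernel \<open>P u x\<close> has zero
  trace against a basis, hence vanishes.\<close>

lemma card_roots_ge_rank:
  fixes g :: "'l::finite \<Rightarrow> 'f::finite_field poly"
  assumes "CARD('f) = 2 ^ l" and "bbasis \<beta>"
  shows "2 ^ CARD('l) \<le> card {u. poly (comb_poly g u) x = 0} * 2 ^ rank (repair_matrix g \<beta> x)"
proof -
  let ?W = "repair_matrix g \<beta> x"
  let ?f = "\<lambda>u. \<chi> s. btrace (poly (comb_poly g u) x * \<beta> s)"
  have "additive_on UNIV ?f"
    by (auto simp: additive_on_def vec_eq_iff comb_poly_add[OF assms(1)] distrib_right btrace_add[OF assms(1)])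
  from card_le_kernel_image[OF finite_subgroup_UNIV this]
  have "2 ^ CARD('l) \<le> card {u. ?f u = 0} * card (range ?f)"
    by (simp add: CARD_bit)
  also have "\<dots> \<le> card {u. poly (comb_poly g u) x = 0} * 2 ^ rank ?W"
  proof (rule mult_le_mono)
    have "poly (comb_poly g u) x = 0" if "?f u = 0" for u
    proof (rule btrace_nondegenerate[OF assms(1)])
      fix y
      show "btrace (poly (comb_poly g u) x * y) = 0"
      proof (rule btrace_eq_0_span[OF assms(1), of "range \<beta>"])
        show "btrace (poly (comb_poly g u) x * y) = 0" if "y \<in> range \<beta>" for y
          using that \<open>?f u = 0\<close> by (auto simp: vec_eq_iff)
        show "y \<in> bspan (range \<beta>)"
          using assms(2) by (simp add: bbasis_def)
      qed
    qed
    then show "card {u. ?f u = 0} \<le> card {u. poly (comb_poly g u) x = 0}"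
      by (intro card_mono) auto
    have "?f u \<in> vec.span (rows ?W)" for u
    proof -
      have "?f u = (\<Sum>j\<in>UNIV. u $ j *s row j ?W)"
        by (simp add: vec_eq_iff btrace_poly_comb_poly[OF assms(1)] row_def repair_matrix_def)
      also have "\<dots> \<in> vec.span (rows ?W)"
        by (intro vec.span_sum vec.span_scale vec.span_base) (auto simp: rows_def)
      finally show ?thesis .
    qed
    then have "card (range ?f) \<le> card (vec.span (rows ?W))"
      by (intro card_mono) auto
    then show "card (range ?f) \<le> 2 ^ rank ?W"
      using card_span_rows_le[of ?W] by linarith
  qed
  finally show ?thesis .
qed

section \<open>Zero columns at an I/O-optimal scheme\<close>

lemma card_small_degree_roots:
  assumes "degree p \<le> k" and "p \<noteq> 0"
  shows "card {x \<in> S. poly (p :: 'f::finite_field poly) x = 0} \<le> k"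
proof -
  have "card {x \<in> S. poly p x = 0} \<le> card {x. poly p x = 0}"
    by (intro card_mono) auto
  then show ?thesis
    using card_poly_roots_bound[OF assms(2)] assms(1) by linarith
qed

lemma quadratic_poly:
  fixes p :: "'a::comm_ring_1 poly"
  assumes "degree p \<le> 2"
  shows "poly p x = poly.coeff p 0 + poly.coeff p 1 * x + poly.coeff p 2 * x ^ 2"
proof -
  have "poly p x = (\<Sum>i\<le>2. poly.coeff p i * x ^ i)"
    unfolding poly_altdef using assms by (intro sum.mono_neutral_left) (auto simp: coeff_eq_0)
  then show ?thesis
    by (simp add: numeral_2_eq_2)
qed

lemma square_add:
  assumes "CARD('f::finite_field) = 2 ^ l"
  shows "(x + y :: 'f) ^ 2 = x ^ 2 + y ^ 2"
  using char2_add_self[OF assms, of "x * y"] by (simp add: power2_eq_square algebra_simps)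

text \<open>Squaring is additive in characteristic two, so a quadratic is additive up to a constant.
  The origin \<open>z\<close> is free because \<open>card_zero_nodes\<close> moves it to a common
  zero.\<close>

lemma quadratic_poly_affine:
  fixes p :: "'f::finite_field poly"
  assumes "CARD('f) = 2 ^ l" and "degree p \<le> 2"
  shows "poly p (z + (x + y)) = poly p (z + x) + poly p (z + y) - poly p z"
  unfolding quadratic_poly[OF assms(2)] square_add[OF assms(1)] by (simp add: algebra_simps)

text \<open>The trace is invariant under squaring, so \<open>b * x * y\<close> may be replaced by
  its square. Then \<open>h y\<close> is trace-orthogonal to all squares \<open>x ^ 2\<close> with
  \<open>x\<close> in \<open>A\<close>. As \<open>h\<close> has at most two zeros in
  \<open>Y\<close>, \<open>card Y\<close> is at most twice the size of the annihilator of these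
  squares, against \<open>less\<close>.\<close>

lemma degree_0_if_btrace_0:
  fixes p :: "'f::finite_field poly"
  assumes F: "CARD('f) = 2 ^ l" and A: "finite_subgroup A" and Y: "finite_subgroup Y"
    and less: "2 * 2 ^ l < card A * card Y" and deg: "degree p \<le> 2"
    and zero: "\<And>x y. x \<in> A \<Longrightarrow> y \<in> Y \<Longrightarrow> btrace (poly p x * y) = 0"
  shows "degree p = 0"
proof (rule ccontr)
  assume "degree p \<noteq> 0"
  define a b where "a = poly.coeff p 2" and "b = poly.coeff p 1"
  have ab: "a \<noteq> 0 \<or> b \<noteq> 0"
  proof -
    have "degree p = 1 \<or> degree p = 2"
      using deg \<open>degree p \<noteq> 0\<close> by linarith
    moreover have "poly.coeff p (degree p) \<noteq> 0"
      using \<open>degree p \<noteq> 0\<close> by auto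
    ultimately show ?thesis
      unfolding a_def b_def by metis
  qed
  \<comment> \<open>The coefficient of \<open>x ^ 2\<close> after the linear term has been squared;
    it is additive in \<open>y\<close>.\<close>
  define h where "h y = b ^ 2 * y ^ 2 + a * y" for y
  define S where "S = (\<lambda>x. x ^ 2) ` A"
  define D where "D = {z. \<forall>s\<in>S. btrace (z * s) = 0}"
  have h: "btrace (h y * x ^ 2) = 0" if "x \<in> A" "y \<in> Y" for x y
  proof -
    have "h y * x ^ 2 = (b * x * y) ^ 2 + a * x ^ 2 * y"
      by (simp add: h_def power_mult_distrib algebra_simps)
    then have "btrace (h y * x ^ 2) = btrace (b * x * y) + btrace (a * x ^ 2 * y)"
      by (simp only: btrace_add[OF F] btrace_square[OF F])
    also have "\<dots> = btrace (poly p x * y) - btrace (poly p 0 * y)"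
      by (simp add: quadratic_poly[OF deg] a_def b_def distrib_right btrace_add[OF F])
    also have "\<dots> = 0"
      using zero that finite_subgroupD(2)[OF A] by simp
    finally show ?thesis .
  qed
  have sq_diff: "(x - y) ^ 2 = x ^ 2 - y ^ 2" for x y :: 'f
    using square_add[OF F, of "x - y" y] by simp
  have "finite_subgroup S"
    unfolding finite_subgroup_def S_def
    using finite_subgroupD[OF A] by (auto simp flip: sq_diff intro: image_eqI[of _ _ 0])
  moreover have "card S = card A"
    unfolding S_def
  proof (intro card_image inj_onI)
    show "x = y" if "x ^ 2 = y ^ 2" for x y :: 'f
      using sq_diff[of x y] that by simp
  qed
  ultimately have D: "card A * card D = 2 ^ l"
    using card_btrace_annihilator[OF F, of S] by (simp add: D_def)
  have "additive_on Y h"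
    by (auto simp: additive_on_def h_def square_add[OF F] algebra_simps)
  from card_le_kernel_image[OF Y this]
  have "card Y \<le> card {y \<in> Y. h y = 0} * card (h ` Y)" .
  also have "\<dots> \<le> 2 * card D"
  proof (rule mult_le_mono)
    have "[:0, a, b ^ 2:] \<noteq> 0"
      using ab by simp
    moreover have "poly [:0, a, b ^ 2:] y = h y" for y
      by (simp add: h_def power2_eq_square algebra_simps)
    moreover have "degree [:0, a, b ^ 2:] \<le> 2"
      by simp
    ultimately show "card {y \<in> Y. h y = 0} \<le> 2"
      using card_small_degree_roots[of "[:0, a, b ^ 2:]" 2 Y] by simp
    show "card (h ` Y) \<le> card D"
      using h by (intro card_mono) (auto simp: D_def S_def)
  qed
  finally have "card A * card Y \<le> 2 * (card A * card D)"
    by simp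
  then show False
    using less D by simp
qed

section \<open>Nodes and combinations attached to a column\<close>

text \<open>For \<open>y = \<beta> s\<close>, this set and \<open>zero_combs A g y\<close> are
  \<open>Z s\<close> and \<open>K s\<close> of the overview.\<close>

definition zero_nodes :: "'f::finite_field set \<Rightarrow> ('l::finite \<Rightarrow> 'f poly) \<Rightarrow> 'f \<Rightarrow> 'f set"
  where "zero_nodes A g y = {x \<in> A. \<forall>u. btrace (poly (comb_poly g u) x * y) = 0}"

definition zero_combs :: "'f::finite_field set \<Rightarrow> ('l::finite \<Rightarrow> 'f poly) \<Rightarrow> 'f \<Rightarrow> (bit ^ 'l) set"
  where "zero_combs A g y = {u. \<forall>x\<in>A. btrace (poly (comb_poly g u) x * y) = 0}"

lemma column_repair_matrix_eq_0:
  fixes g :: "'l::finite \<Rightarrow> 'f::finite_field poly"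
  assumes "CARD('f) = 2 ^ l"
  shows "column s (repair_matrix g \<beta> x) = 0 \<longleftrightarrow> (\<forall>u. btrace (poly (comb_poly g u) x * \<beta> s) = 0)"
proof
  assume "column s (repair_matrix g \<beta> x) = 0"
  then have "btrace (poly (g j) x * \<beta> s) = 0" for j
    by (auto simp: column_def repair_matrix_def vec_eq_iff)
  then show "\<forall>u. btrace (poly (comb_poly g u) x * \<beta> s) = 0"
    by (simp only: btrace_poly_comb_poly[OF assms]) simp
next
  assume "\<forall>u. btrace (poly (comb_poly g u) x * \<beta> s) = 0"
  \<comment> \<open>The unit vector recovers the single polynomial \<open>g j\<close>.\<close>
  then have "(\<Sum>i\<in>UNIV. axis j 1 $ i * btrace (poly (g i) x * \<beta> s)) = 0" for j
    by (simp only: btrace_poly_comb_poly[OF assms])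
  then have "btrace (poly (g j) x * \<beta> s) = 0" for j
    by (simp add: axis_def if_distrib[where f = "\<lambda>x. x * _"] cong: if_cong)
  then show "column s (repair_matrix g \<beta> x) = 0"
    by (simp add: column_def repair_matrix_def vec_eq_iff)
qed

lemma finite_subgroup_zero_combs:
  assumes "CARD('f::finite_field) = 2 ^ l"
  shows "finite_subgroup (zero_combs A (g :: 'l::finite \<Rightarrow> 'f poly) y)"
proof -
  have "finite_subgroup {u \<in> UNIV. \<forall>x\<in>A. btrace (poly (comb_poly g u) x * y) = 0}"
    by (intro finite_subgroup_kernel finite_subgroup_UNIV)
      (simp add: additive_on_def comb_poly_add[OF assms] distrib_right btrace_add[OF assms])
  then show ?thesis
    by (simp add: zero_combs_def)
qed

text \<open>The map is additive and injective by independence, and both sides have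
  \<open>2 ^ CARD('l)\<close> elements.\<close>

lemma bij_comb_poly:
  fixes g :: "'l::finite \<Rightarrow> 'f::finite_field poly"
  assumes F: "CARD('f) = 2 ^ CARD('l)" and ind: "bindep_family (\<lambda>j. poly (g j) \<alpha>)"
  shows "bij (\<lambda>u. poly (comb_poly g u) \<alpha>)"
proof -
  let ?f = "\<lambda>u. poly (comb_poly g u) \<alpha>"
  have "additive_on UNIV ?f"
    by (simp add: additive_on_def comb_poly_add[OF F])
  from additive_on_diff[OF finite_subgroup_UNIV this]
  have inj: "inj ?f"
    using comb_poly_eq_0[OF F ind] by (intro injI) (metis UNIV_I eq_iff_diff_eq_0)
  have "card (range ?f) = CARD('f)"
    using inj F by (simp add: card_image CARD_bit)
  then have "range ?f = UNIV"
    by (intro card_subset_eq) auto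
  with inj show ?thesis
    by (simp add: bij_def)
qed

text \<open>With the origin moved to a common zero \<open>z\<close>, the trace is additive in
  \<open>u\<close> and in \<open>x\<close>. Then \<open>card_annihilator\<close> compares a
  translate of the zero nodes with the zero combinations, and \<open>r\<close> is their common
  codimension.\<close>

lemma card_zero_nodes:
  fixes g :: "'l::finite \<Rightarrow> 'f::finite_field poly"
  assumes F: "CARD('f) = 2 ^ CARD('l)" and A: "finite_subgroup A" "card A = 2 ^ d" "\<alpha> \<in> A"
    and ind: "bindep_family (\<lambda>j. poly (g j) \<alpha>)" and deg: "\<And>j. degree (g j) \<le> 2"
    and y: "y \<noteq> 0" and ne: "zero_nodes A g y \<noteq> {}"
  shows "\<exists>r. 1 \<le> r \<and> card (zero_nodes A g y) * 2 ^ r = 2 ^ d \<and>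
    card (zero_combs A g y) * 2 ^ r = 2 ^ CARD('l)"
proof -
  obtain z where z: "z \<in> A" "\<And>u. btrace (poly (comb_poly g u) z * y) = 0"
    using ne by (auto simp: zero_nodes_def)
  let ?f = "\<lambda>u x. btrace (poly (comb_poly g u) (z + x) * y)"
  let ?Z = "{x \<in> A. \<forall>u\<in>UNIV. ?f u x = 0}"
  have diff: "btrace (x - x') = btrace x - btrace x'" for x x' :: 'f
    using btrace_add[OF F, of "x - x'" x'] by simp
  \<comment> \<open>The constant \<open>P u z\<close> has trace zero against \<open>y\<close> by the
    choice of \<open>z\<close>, which makes the affine function additive.\<close>
  have addA: "additive_on A (\<lambda>x. ?f u x)" for u
    unfolding additive_on_def
    by (simp add: quadratic_poly_affine[OF F degree_comb_poly[OF deg]] left_diff_distrib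
        distrib_right diff btrace_add[OF F] z)
  have "card (UNIV :: (bit ^ 'l) set) * card ?Z = card A * card {u \<in> UNIV. \<forall>x\<in>A. ?f u x = 0}"
    using addA by (intro card_annihilator finite_subgroup_UNIV A)
      (simp_all add: additive_on_def comb_poly_add[OF F] distrib_right btrace_add[OF F])
  moreover have "{u \<in> UNIV. \<forall>x\<in>A. ?f u x = 0} = zero_combs A g y"
  proof -
    have "(+) z ` A = A"
      using finite_subgroupD[OF A(1)] z(1) by (intro endo_inj_surj) (auto simp: inj_on_def)
    then have "(\<forall>x\<in>A. P (z + x)) \<longleftrightarrow> (\<forall>x\<in>A. P x)" for P
      by (metis image_iff imageI)
    then have "(\<forall>x\<in>A. ?f u x = 0) \<longleftrightarrow> (\<forall>x\<in>A. btrace (poly (comb_poly g u) x * y) = 0)" for u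
      .
    then show ?thesis
      unfolding zero_combs_def by blast
  qed
  moreover have cardZ: "card ?Z = card (zero_nodes A g y)"
  proof (rule bij_betw_same_card)
    show "bij_betw ((+) z) ?Z (zero_nodes A g y)"
      using finite_subgroupD[OF A(1)] z(1)
      by (intro bij_betw_byWitness[where f' = "\<lambda>x. x - z"]) (auto simp: zero_nodes_def)
  qed
  ultimately have eq: "2 ^ CARD('l) * card (zero_nodes A g y) = 2 ^ d * card (zero_combs A g y)"
    by (simp add: CARD_bit A(2))
  have "finite_subgroup ?Z"
    using addA by (intro finite_subgroup_kernel A)
  from card_finite_subgroup[OF F this] obtain k where k: "card (zero_nodes A g y) = 2 ^ k"
    unfolding cardZ by blast
  \<comment> \<open>The values at \<open>\<alpha>\<close> fill the field, so otherwise
    \<open>y\<close> would be orthogonal to everything. Properness of the zero set gives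
    \<open>1 \<le> r\<close>.\<close>
  have "\<alpha> \<notin> zero_nodes A g y"
  proof
    assume "\<alpha> \<in> zero_nodes A g y"
    then have "btrace (poly (comb_poly g u) \<alpha> * y) = 0" for u
      by (simp add: zero_nodes_def)
    moreover have "\<exists>u. x = poly (comb_poly g u) \<alpha>" for x
      using surjD[OF bij_is_surj[OF bij_comb_poly[OF F ind]]] by simp
    ultimately have "btrace (y * x) = 0" for x
      unfolding mult.commute[of y x] by metis
    then show False
      using btrace_nondegenerate[OF F] y by blast
  qed
  moreover have "zero_nodes A g y \<subseteq> A"
    by (auto simp: zero_nodes_def)
  ultimately have "zero_nodes A g y \<subset> A"
    using A(3) by blast
  then have "card (zero_nodes A g y) < card A"
    by (intro psubset_card_mono) auto
  then have "k < d"
    by (simp add: k A(2))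
  then have "(2::nat) ^ d = 2 ^ (d - k) * 2 ^ k"
    by (simp flip: power_add)
  with eq have "card (zero_combs A g y) * 2 ^ (d - k) = 2 ^ CARD('l)"
    by (simp add: k)
  then show ?thesis
    using \<open>k < d\<close> k by (intro exI[of _ "d - k"]) (simp flip: power_add)
qed

section \<open>Selection of columns of small codimension\<close>

text \<open>Take \<open>T\<close> with the least sum of \<open>r\<close>. If some \<open>r t\<close>
  in it exceeds 2, the sum over \<open>Q\<close> is at most that of
  \<open>r t * (1 / 2) ^ r t\<close> over \<open>T\<close>. This is less than \<open>m / 2\<close>,
  since \<open>k * (1 / 2) ^ k \<le> 1 / 2\<close> for \<open>k \<ge> 1\<close>, strictly from
  \<open>k = 3\<close> on.\<close>

lemma exists_small_subset:
  fixes r :: "'s \<Rightarrow> nat"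
  assumes fin: "finite Q" and r: "\<And>s. s \<in> Q \<Longrightarrow> 1 \<le> r s"
    and sum: "(\<Sum>s\<in>Q. (1 / 2) ^ r s) = (real m / 2)"
    and card: "\<And>T. T \<subseteq> Q \<Longrightarrow> card T = m \<Longrightarrow> card Q \<le> (\<Sum>t\<in>T. r t)"
  shows "\<exists>T\<subseteq>Q. card T = m \<and> (\<forall>t\<in>T. r t \<le> 2)"
proof -
  have half: "(1 / 2 :: real) ^ k \<le> 1 / 2" if "1 \<le> k" for k :: nat
    using power_decreasing[OF that, of "1 / 2 :: real"] by simp
  have mono: "real k * (1 / 2) ^ k \<le> real j * (1 / 2) ^ j" if "1 \<le> j" "j \<le> k" for j k :: nat
    using that(2)
  proof (induction k rule: dec_induct)
    case (step k)
    have "real (Suc k) * (1 / 2) ^ Suc k \<le> (2 * real k) * (1 / 2) ^ Suc k"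
      using step that(1) by (intro mult_right_mono) auto
    also have "\<dots> = real k * (1 / 2) ^ k"
      by simp
    finally show ?case
      using step by linarith
  qed simp
  have bound: "real k * (1 / 2) ^ k \<le> 1 / 2" if "1 \<le> k" for k :: nat
    using mono[of 1 k] that by simp
  have strict: "real k * (1 / 2) ^ k < 1 / 2" if "3 \<le> k" for k :: nat
    using mono[of 3 k] that by (simp add: power3_eq_cube)
  \<comment> \<open>Each summand is at most a half, so \<open>Q\<close> has at least
    \<open>m\<close> elements and a candidate for \<open>T\<close> exists.\<close>
  have "real m / 2 \<le> (\<Sum>s\<in>Q. 1 / 2)"
    unfolding sum[symmetric] by (intro sum_mono half r)
  then have mQ: "m \<le> card Q"
    by simp
  then obtain T0 where "T0 \<subseteq> Q" "card T0 = m"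
    using obtain_subset_with_card_n by metis
  then have "\<exists>T. (T \<subseteq> Q \<and> card T = m) \<and>
      (\<forall>T'. T' \<subseteq> Q \<and> card T' = m \<longrightarrow> (\<Sum>t\<in>T. r t) \<le> (\<Sum>t\<in>T'. r t))"
    by (intro ex_has_least_nat[of _ T0] conjI)
  then obtain T where T: "T \<subseteq> Q" "card T = m"
    and min: "\<And>T'. T' \<subseteq> Q \<Longrightarrow> card T' = m \<Longrightarrow> (\<Sum>t\<in>T. r t) \<le> (\<Sum>t\<in>T'. r t)"
    by blast
  have finT: "finite T"
    using T(1) fin by (rule finite_subset)
  \<comment> \<open>Otherwise trading \<open>t\<close> for \<open>s\<close> would lower the minimal
    sum.\<close>
  have exchange: "r t \<le> r s" if "t \<in> T" "s \<in> Q - T" for s t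
  proof -
    have "card (insert s (T - {t})) = Suc (card (T - {t}))"
      using that finT by (intro card_insert_disjoint) auto
    also have "\<dots> = m"
      unfolding T(2)[symmetric] by (rule card.remove[OF finT that(1), symmetric])
    finally have "(\<Sum>t\<in>T. r t) \<le> (\<Sum>t\<in>insert s (T - {t}). r t)"
      using that T by (intro min) auto
    also have "\<dots> = r s + (\<Sum>t\<in>T - {t}. r t)"
      using that finT by simp
    finally show ?thesis
      using that finT by (simp add: sum.remove[of T t])
  qed
  have "r t \<le> 2" if t: "t \<in> T" for t
  proof (rule ccontr)
    assume "\<not> r t \<le> 2"
    define \<rho> where "\<rho> = Max (r ` T)"
    have \<rho>: "r t \<le> \<rho>" if "t \<in> T" for t
      using that finT by (simp add: \<rho>_def)
    have "\<rho> \<in> r ` T"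
      using t finT unfolding \<rho>_def by (intro Max_in) auto
    then have \<rho>': "\<rho> \<le> r s" if "s \<in> Q - T" for s
      using that exchange by auto
    have pow: "(1 / 2 :: real) ^ j \<le> (1 / 2) ^ i" if "i \<le> j" for i j :: nat
      using that by (intro power_decreasing) auto
    have "(\<Sum>s\<in>Q. (1 / 2 :: real) ^ r s) = (\<Sum>s\<in>T. (1 / 2) ^ r s) + (\<Sum>s\<in>Q - T. (1 / 2) ^ r s)"
      using T(1) fin by (simp add: sum.subset_diff add.commute)
    also have "(\<Sum>s\<in>Q - T. (1 / 2 :: real) ^ r s) \<le> (\<Sum>s\<in>Q - T. (1 / 2) ^ \<rho>)"
      by (intro sum_mono pow \<rho>')
    also have "\<dots> = (real (card Q) - real m) * (1 / 2) ^ \<rho>"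
      using T finT mQ by (simp add: card_Diff_subset of_nat_diff)
    \<comment> \<open>By \<open>card\<close>, the elements outside \<open>T\<close> can be charged
      to those of \<open>T\<close>, at most \<open>r t - 1\<close> of them to each
      \<open>t\<close>.\<close>
    also have "\<dots> \<le> (\<Sum>t\<in>T. real (r t) - 1) * (1 / 2) ^ \<rho>"
    proof (rule mult_right_mono)
      have "real (card Q) \<le> (\<Sum>t\<in>T. real (r t))"
        using card[OF T] by (simp flip: of_nat_sum)
      then show "real (card Q) - real m \<le> (\<Sum>t\<in>T. real (r t) - 1)"
        by (simp add: sum_subtractf T)
    qed simp
    also have "\<dots> \<le> (\<Sum>t\<in>T. (real (r t) - 1) * (1 / 2) ^ r t)"
      unfolding sum_distrib_right using r T(1)
      by (intro sum_mono mult_left_mono pow \<rho>) force+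
    also have "(\<Sum>s\<in>T. (1 / 2 :: real) ^ r s) + \<dots> = (\<Sum>t\<in>T. real (r t) * (1 / 2) ^ r t)"
      by (simp add: sum.distrib[symmetric] algebra_simps)
    also have "\<dots> < (\<Sum>t\<in>T. 1 / 2)"
    proof (rule sum_strict_mono_ex1)
      show "\<forall>t\<in>T. real (r t) * (1 / 2) ^ r t \<le> 1 / 2"
        using r T(1) by (intro ballI bound) blast
      show "\<exists>t\<in>T. real (r t) * (1 / 2) ^ r t < 1 / 2"
        using t \<open>\<not> r t \<le> 2\<close> by (intro bexI[of _ t] strict) auto
    qed (rule finT)
    also have "\<dots> = real m / 2"
      using T by simp
    finally show False
      using sum by simp
  qed
  then show ?thesis
    using T by blast
qed

section \<open>From the I/O cost to constant combinations\<close>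

lemma sum_card_swap:
  assumes "finite A" and "finite B"
  shows "(\<Sum>x\<in>A. card {y \<in> B. P x y}) = (\<Sum>y\<in>B. card {x \<in> A. P x y})"
proof -
  have "(\<Sum>x\<in>A. \<Sum>y\<in>B. if P x y then 1 else 0 :: nat) = (\<Sum>y\<in>B. \<Sum>x\<in>A. if P x y then 1 else 0)"
    by (rule sum.swap)
  then show ?thesis
    using assms by (simp add: sum.If_cases Int_def)
qed

text \<open>Zero columns are counted by column index instead of by node.\<close>

lemma io_cost_eq_zero_nodes:
  fixes g :: "'l::finite \<Rightarrow> 'f::finite_field poly"
  assumes F: "CARD('f) = 2 ^ l"
  shows "io_cost A g \<beta> =
    (int (card A) - 1) * int CARD('l) - int (\<Sum>s\<in>UNIV. card (zero_nodes A g (\<beta> s)))"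
proof -
  let ?W = "\<lambda>x. repair_matrix g \<beta> x"
  have "int (nz (?W x)) = int CARD('l) - int (card {s \<in> UNIV. column s (?W x) = 0})" for x
  proof -
    have "CARD('l) = card ({s. column s (?W x) \<noteq> 0} \<union> {s. column s (?W x) = 0})"
      by (rule arg_cong[where f = card]) auto
    also have "\<dots> = nz (?W x) + card {s. column s (?W x) = 0}"
      unfolding nz_def by (rule card_Un_disjoint) auto
    finally show ?thesis
      by simp
  qed
  then have "(\<Sum>x\<in>A. int (nz (?W x))) =
      int (card A) * int CARD('l) - int (\<Sum>x\<in>A. card {s \<in> UNIV. column s (?W x) = 0})"
    by (simp add: sum_subtractf)
  also have "(\<Sum>x\<in>A. card {s \<in> UNIV. column s (?W x) = 0}) = (\<Sum>s\<in>UNIV. card (zero_nodes A g (\<beta> s)))"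
    by (subst sum_card_swap) (simp_all add: zero_nodes_def column_repair_matrix_eq_0[OF F])
  finally show ?thesis
    by (simp add: io_cost_def left_diff_distrib)
qed

lemma card_bspan_image:
  assumes "CARD('f::finite_field) = 2 ^ l" and "bbasis (\<beta> :: _ \<Rightarrow> 'f)"
  shows "card (bspan (\<beta> ` T)) = 2 ^ card T" and "finite_subgroup (bspan (\<beta> ` T))"
proof -
  interpret vector_space "bscale :: bit \<Rightarrow> 'f \<Rightarrow> 'f"
    using assms(1) by (rule vector_space_bscale)
  have "inj \<beta>" "independent (range \<beta>)"
    using assms(2) by (auto simp: bbasis_def bindep_family_def)
  then have "independent (\<beta> ` T)"
    by (rule_tac independent_mono) auto
  from card_bspan[OF assms(1) this] show "card (bspan (\<beta> ` T)) = 2 ^ card T"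
    using \<open>inj \<beta>\<close> by (simp add: card_image inj_on_subset[OF _ subset_UNIV])
  show "finite_subgroup (bspan (\<beta> ` T))"
    by (simp add: finite_subgroup_bsubspace[OF assms(1)])
qed

lemma card_constant_combs:
  fixes g :: "'l::finite \<Rightarrow> 'f::finite_field poly" and \<beta> :: "'l \<Rightarrow> 'f"
  assumes F: "CARD('f) = 2 ^ CARD('l)" and A: "finite_subgroup A" "card A = 2 ^ d" "\<alpha> \<in> A"
    and ind: "bindep_family (\<lambda>j. poly (g j) \<alpha>)" and deg: "\<And>j. degree (g j) \<le> 2"
    and \<beta>: "bbasis \<beta>" and d: "1 \<le> d" and m: "m + d = CARD('l) + 2"
    and sum: "(\<Sum>s\<in>UNIV. card (zero_nodes A g (\<beta> s))) = m * 2 ^ (d - 1)"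
  shows "2 ^ CARD('l) \<le> card {u. degree (comb_poly g u) = 0} * 2 ^ (2 * m)"
proof -
  define Q where "Q = {s. zero_nodes A g (\<beta> s) \<noteq> {}}"
  let ?K = "\<lambda>s. zero_combs A g (\<beta> s)"
  let ?C = "{u. degree (comb_poly g u) = 0}"
  have "\<beta> s \<noteq> 0" for s
  proof -
    interpret vector_space "bscale :: bit \<Rightarrow> 'f \<Rightarrow> 'f"
      using F by (rule vector_space_bscale)
    have "0 \<notin> range \<beta>"
      using \<beta> dependent_zero[of "range \<beta>"] unfolding bbasis_def bindep_family_def by blast
    then show ?thesis
      by (metis rangeI)
  qed
  then have "\<forall>s\<in>Q. \<exists>r. 1 \<le> r \<and> card (zero_nodes A g (\<beta> s)) * 2 ^ r = 2 ^ d \<and>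
      card (?K s) * 2 ^ r = 2 ^ CARD('l)"
    using card_zero_nodes[OF F A ind deg] by (simp add: Q_def)
  then obtain r where r: "\<And>s. s \<in> Q \<Longrightarrow> 1 \<le> r s"
    and Z: "\<And>s. s \<in> Q \<Longrightarrow> card (zero_nodes A g (\<beta> s)) * 2 ^ r s = 2 ^ d"
    and K: "\<And>s. s \<in> Q \<Longrightarrow> card (?K s) * 2 ^ r s = 2 ^ CARD('l)"
    unfolding bchoice_iff by blast
  define KT where "KT T = {u \<in> UNIV. \<forall>t\<in>T. u \<in> ?K t}" for T
  have KT: "2 ^ CARD('l) \<le> card (KT T) * 2 ^ (\<Sum>t\<in>T. r t)" if "T \<subseteq> Q" for T
  proof -
    have "card (UNIV :: (bit ^ 'l) set) \<le> card (KT T) * 2 ^ (\<Sum>t\<in>T. r t)"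
      unfolding KT_def
    proof (rule card_le_card_INT[OF finite_subgroup_UNIV])
      show "finite_subgroup (?K t) \<and> ?K t \<subseteq> UNIV \<and> card (UNIV :: (bit ^ 'l) set) \<le> card (?K t) * 2 ^ r t"
        if "t \<in> T" for t
        using that \<open>T \<subseteq> Q\<close> K finite_subgroup_zero_combs[OF F] by (simp add: subset_iff CARD_bit)
    qed simp
    then show ?thesis
      by (simp add: CARD_bit)
  qed
  \<comment> \<open>The sizes of \<open>A\<close> and of the span multiply to
    \<open>2 ^ (CARD('l) + 2)\<close>, twice the threshold in
    \<open>degree_0_if_btrace_0\<close>.\<close>
  have const: "degree (comb_poly g u) = 0" if "u \<in> KT T" "card T = m" for u T
  proof (rule degree_0_if_btrace_0[OF F A(1) card_bspan_image(2)[OF F \<beta>, of T] _ degree_comb_poly[OF deg]])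
    have "2 * 2 ^ CARD('l) < (2::nat) ^ (m + d)"
      by (simp add: m)
    then show "2 * 2 ^ CARD('l) < card A * card (bspan (\<beta> ` T))"
      unfolding card_bspan_image(1)[OF F \<beta>] A(2) that(2) power_add by (simp only: mult.commute)
    show "btrace (poly (comb_poly g u) x * y) = 0" if "x \<in> A" "y \<in> bspan (\<beta> ` T)" for x y
      using that(2)
    proof (rule btrace_eq_0_span[OF F, rotated])
      show "btrace (poly (comb_poly g u) x * y) = 0" if "y \<in> \<beta> ` T" for y
        using that \<open>x \<in> A\<close> \<open>u \<in> KT T\<close> by (auto simp: KT_def zero_combs_def)
    qed
  qed
  \<comment> \<open>A constant \<open>P u\<close> takes at \<open>\<alpha>\<close> the value it has
    at a node of \<open>Z s\<close>, hence is orthogonal to \<open>\<beta> s\<close> for every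
    \<open>s\<close> in \<open>Q\<close>. So \<open>KT T\<close> injects into the annihilator of a
    space of dimension \<open>card Q\<close>, and \<open>KT\<close> bounds its size from
    below.\<close>
  have "card Q \<le> (\<Sum>t\<in>T. r t)" if T: "T \<subseteq> Q" "card T = m" for T
  proof -
    let ?D = "{x. \<forall>y\<in>bspan (\<beta> ` Q). btrace (x * y) = 0}"
    let ?e = "\<lambda>u. poly (comb_poly g u) \<alpha>"
    have "?e u \<in> ?D" if u: "u \<in> KT T" for u
    proof -
      have "btrace (?e u * y) = 0" if "y \<in> bspan (\<beta> ` Q)" for y
        using that
      proof (rule btrace_eq_0_span[OF F, rotated])
        fix y assume "y \<in> \<beta> ` Q"
        then obtain z where "btrace (poly (comb_poly g u) z * y) = 0"
          by (auto simp: Q_def zero_nodes_def)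
        moreover obtain c where "comb_poly g u = [:c:]"
          using const[OF u T(2)] by (rule degree_eq_zeroE)
        ultimately show "btrace (?e u * y) = 0"
          by simp
      qed
      then show ?thesis
        by simp
    qed
    then have "?e ` KT T \<subseteq> ?D"
      by blast
    with inj_on_subset[OF bij_is_inj[OF bij_comb_poly[OF F ind]] subset_UNIV]
    have "card (KT T) \<le> card ?D"
      by (rule card_inj_on_le) simp
    then have "2 ^ card Q * card (KT T) \<le> 2 ^ card Q * card ?D"
      by (rule mult_le_mono2)
    also have "2 ^ card Q * card ?D = 2 ^ CARD('l)"
      using card_btrace_annihilator[OF F card_bspan_image(2)[OF F \<beta>, of Q]]
      by (simp add: card_bspan_image(1)[OF F \<beta>])
    also have "\<dots> \<le> 2 ^ (\<Sum>t\<in>T. r t) * card (KT T)"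
      using KT[OF T(1)] by (simp add: mult.commute)
    finally have "(2::nat) ^ card Q \<le> 2 ^ (\<Sum>t\<in>T. r t)"
      using KT[OF T(1)] by (cases "card (KT T) = 0") auto
    then show ?thesis
      by simp
  qed
  \<comment> \<open>Each summand is the proportion of nodes that lie in \<open>Z s\<close>; empty
    \<open>Z s\<close> add nothing.\<close>
  moreover have "(\<Sum>s\<in>Q. (1 / 2) ^ r s) = real m / 2"
  proof -
    have "(1 / 2) ^ r s = real (card (zero_nodes A g (\<beta> s))) / 2 ^ d" if "s \<in> Q" for s
    proof -
      have eq: "(2::real) ^ d = real (card (zero_nodes A g (\<beta> s))) * 2 ^ r s"
        using arg_cong[OF Z[OF that], of real] by simp
      then have "real (card (zero_nodes A g (\<beta> s))) \<noteq> 0"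
        by (metis mult_zero_left power_not_zero zero_neq_numeral)
      then show ?thesis
        unfolding eq by (simp add: power_one_over)
    qed
    then have "(\<Sum>s\<in>Q. (1 / 2) ^ r s) = (\<Sum>s\<in>Q. real (card (zero_nodes A g (\<beta> s)))) / 2 ^ d"
      by (simp add: sum_divide_distrib)
    also have "(\<Sum>s\<in>Q. real (card (zero_nodes A g (\<beta> s)))) = (\<Sum>s\<in>UNIV. real (card (zero_nodes A g (\<beta> s))))"
      by (intro sum.mono_neutral_left) (auto simp: Q_def)
    also have "\<dots> = real m * 2 ^ (d - 1)"
      using arg_cong[OF sum, of real] by simp
    also have "\<dots> / 2 ^ d = real m / 2"
      using d by (cases d) simp_all
    finally show ?thesis .
  qed
  ultimately obtain T where T: "T \<subseteq> Q" "card T = m" "\<forall>t\<in>T. r t \<le> 2"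
    using exists_small_subset[of Q r m] r by auto
  have "(\<Sum>t\<in>T. r t) \<le> (\<Sum>t\<in>T. 2)"
    using T(3) by (intro sum_mono) auto
  then have le: "(\<Sum>t\<in>T. r t) \<le> 2 * m"
    using T(2) by simp
  have "2 ^ CARD('l) \<le> card (KT T) * 2 ^ (\<Sum>t\<in>T. r t)"
    using KT T(1) .
  also have "\<dots> \<le> card ?C * 2 ^ (2 * m)"
  proof (rule mult_le_mono)
    show "card (KT T) \<le> card ?C"
      using const T(2) by (intro card_mono) auto
    show "(2::nat) ^ (\<Sum>t\<in>T. r t) \<le> 2 ^ (2 * m)"
      using le by simp
  qed
  finally show ?thesis .
qed

section \<open>Counting roots\<close>

text \<open>Pairs are counted by \<open>u\<close>: the zero combination vanishes at all
  \<open>card A - 1\<close> nodes, other constants at none, and the remaining combinations at no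
  more than two.\<close>

lemma sum_card_roots_le:
  fixes g :: "'l::finite \<Rightarrow> 'f::finite_field poly"
  assumes F: "CARD('f) = 2 ^ l" and "\<alpha> \<in> A"
    and ind: "bindep_family (\<lambda>j. poly (g j) \<alpha>)" and deg: "\<And>j. degree (g j) \<le> 2"
  shows "(\<Sum>x\<in>A - {\<alpha>}. card {u. poly (comb_poly g u) x = 0}) + 2 * card {u. degree (comb_poly g u) = 0}
    \<le> (card A - 1) + 2 * 2 ^ CARD('l)"
proof -
  let ?C = "{u. degree (comb_poly g u) = 0}"
  have nz: "comb_poly g u \<noteq> 0" if "u \<noteq> 0" for u
    using comb_poly_eq_0[OF F ind, of u] that by auto
  have roots: "card {x \<in> A - {\<alpha>}. poly (comb_poly g u) x = 0} \<le>
      (if u = 0 then card A - 1 else 0) + (if u \<in> ?C then 0 else 2)" for u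
  proof (cases "u = 0")
    case True
    have "card {x \<in> A - {\<alpha>}. poly (comb_poly g u) x = 0} \<le> card (A - {\<alpha>})"
      by (intro card_mono) auto
    then show ?thesis
      using True \<open>\<alpha> \<in> A\<close> by simp
  next
    case False
    have "card {x \<in> A - {\<alpha>}. poly (comb_poly g u) x = 0} \<le> (if u \<in> ?C then 0 else 2)"
      using degree_comb_poly[of g 2, OF deg] by (intro card_small_degree_roots nz False) simp
    then show ?thesis
      using False by simp
  qed
  have "(\<Sum>x\<in>A - {\<alpha>}. card {u. poly (comb_poly g u) x = 0}) =
      (\<Sum>u\<in>UNIV. card {x \<in> A - {\<alpha>}. poly (comb_poly g u) x = 0})"
    using sum_card_swap[of "A - {\<alpha>}" UNIV "\<lambda>x u. poly (comb_poly g u) x = 0"] by simp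
  also have "\<dots> \<le> (\<Sum>u\<in>UNIV. (if u = 0 then card A - 1 else 0) + (if u \<in> ?C then 0 else 2))"
    by (intro sum_mono roots)
  also have "\<dots> = (card A - 1) + 2 * card (- ?C)"
    by (simp add: sum.distrib sum.If_cases Compl_eq)
  also have "card (- ?C) = 2 ^ CARD('l) - card ?C"
    using card_Diff_subset[of ?C UNIV] by (simp add: Compl_eq_Diff_UNIV CARD_bit)
  finally have *: "(\<Sum>x\<in>A - {\<alpha>}. card {u. poly (comb_poly g u) x = 0}) \<le>
      (card A - 1) + 2 * (2 ^ CARD('l) - card ?C)" .
  \<comment> \<open>Ensures that the subtraction in \<open>*\<close> does not truncate.\<close>
  have "card ?C \<le> card (UNIV :: (bit ^ 'l) set)"
    by (intro card_mono) auto
  then have "card ?C \<le> 2 ^ CARD('l)"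
    unfolding CARD_bit_vec .
  with * show ?thesis
    by linarith
qed

text \<open>Only \<open>u = 0\<close> gives a zero at the failed node, so its matrix has rank at
  least \<open>CARD('l)\<close> and absorbs the subtracted term.\<close>

lemma rank_sum_le_repair_bandwidth:
  fixes g :: "'l::finite \<Rightarrow> 'f::finite_field poly"
  assumes F: "CARD('f) = 2 ^ l" and "\<alpha> \<in> A"
    and ind: "bindep_family (\<lambda>j. poly (g j) \<alpha>)" and \<beta>: "bbasis \<beta>"
  shows "int (\<Sum>x\<in>A - {\<alpha>}. rank (repair_matrix g \<beta> x)) \<le> repair_bandwidth A g \<beta>"
proof -
  have "{u. poly (comb_poly g u) \<alpha> = 0} \<subseteq> {0}"
    using comb_poly_eq_0[OF F ind] by auto
  then have "card {u. poly (comb_poly g u) \<alpha> = 0} \<le> card {0 :: bit ^ 'l}"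
    by (rule card_mono[rotated]) simp
  then have "card {u. poly (comb_poly g u) \<alpha> = 0} \<le> 1"
    by simp
  from mult_le_mono1[OF this, of "2 ^ rank (repair_matrix g \<beta> \<alpha>)"]
  have "2 ^ CARD('l) \<le> (2::nat) ^ rank (repair_matrix g \<beta> \<alpha>)"
    using card_roots_ge_rank[OF F \<beta>, of g \<alpha>] by (simp only: mult_1 order_trans)
  then have "CARD('l) \<le> rank (repair_matrix g \<beta> \<alpha>)"
    by simp
  then show ?thesis
    using \<open>\<alpha> \<in> A\<close> by (simp add: repair_bandwidth_def sum.remove[of A \<alpha>])
qed

text \<open>At least three other nodes remain, more than the roots of a nonzero quadratic. Hence the
  subspaces \<open>?N x\<close> meet only in 0, while each has codimension at most the rank at
  \<open>x\<close>.\<close>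

lemma repair_bandwidth_ge_length:
  fixes g :: "'l::finite \<Rightarrow> 'f::finite_field poly"
  assumes F: "CARD('f) = 2 ^ l" and "\<alpha> \<in> A" and A: "card A \<ge> 4"
    and ind: "bindep_family (\<lambda>j. poly (g j) \<alpha>)" and deg: "\<And>j. degree (g j) \<le> 2" and \<beta>: "bbasis \<beta>"
  shows "int CARD('l) \<le> repair_bandwidth A g \<beta>"
proof -
  let ?N = "\<lambda>x. {u. poly (comb_poly g u) x = 0}"
  let ?R = "\<lambda>x. rank (repair_matrix g \<beta> x)"
  have "card (UNIV :: (bit ^ 'l) set) \<le> card {u \<in> UNIV. \<forall>x\<in>A - {\<alpha>}. u \<in> ?N x} * 2 ^ (\<Sum>x\<in>A - {\<alpha>}. ?R x)"
  proof (rule card_le_card_INT[OF finite_subgroup_UNIV])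
    fix x
    have "finite_subgroup {u \<in> UNIV. \<forall>x\<in>{x}. poly (comb_poly g u) x = 0}"
      by (intro finite_subgroup_kernel finite_subgroup_UNIV) (simp add: additive_on_def comb_poly_add[OF F])
    then show "finite_subgroup (?N x) \<and> ?N x \<subseteq> UNIV \<and>
        card (UNIV :: (bit ^ 'l) set) \<le> card (?N x) * 2 ^ ?R x"
      using card_roots_ge_rank[OF F \<beta>, of g x] by (simp add: CARD_bit)
  qed simp
  moreover
  have "{u \<in> UNIV. \<forall>x\<in>A - {\<alpha>}. u \<in> ?N x} \<subseteq> {0}"
  proof
    fix u assume u: "u \<in> {u \<in> UNIV. \<forall>x\<in>A - {\<alpha>}. u \<in> ?N x}"
    then have "{x \<in> A - {\<alpha>}. poly (comb_poly g u) x = 0} = A - {\<alpha>}"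
      by auto
    then have "\<not> card {x \<in> A - {\<alpha>}. poly (comb_poly g u) x = 0} \<le> 2"
      using A \<open>\<alpha> \<in> A\<close> by simp
    then have "comb_poly g u = 0"
      using card_small_degree_roots[OF degree_comb_poly[of g 2, OF deg]] by blast
    then show "u \<in> {0}"
      using comb_poly_eq_0[OF F ind, of u] by simp
  qed
  then have "card {u \<in> UNIV. \<forall>x\<in>A - {\<alpha>}. u \<in> ?N x} \<le> card {0 :: bit ^ 'l}"
    by (rule card_mono[rotated]) simp
  then have "card {u \<in> UNIV. \<forall>x\<in>A - {\<alpha>}. u \<in> ?N x} \<le> 1"
    by simp
  from mult_le_mono1[OF this, of "2 ^ (\<Sum>x\<in>A - {\<alpha>}. ?R x)"]
  have "card {u \<in> UNIV. \<forall>x\<in>A - {\<alpha>}. u \<in> ?N x} * 2 ^ (\<Sum>x\<in>A - {\<alpha>}. ?R x) \<le>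
      2 ^ (\<Sum>x\<in>A - {\<alpha>}. ?R x)"
    by (simp only: mult_1)
  ultimately have "2 ^ CARD('l) \<le> (2::nat) ^ (\<Sum>x\<in>A - {\<alpha>}. ?R x)"
    unfolding CARD_bit_vec by (rule order_trans)
  then have "CARD('l) \<le> (\<Sum>x\<in>A - {\<alpha>}. ?R x)"
    by simp
  then show ?thesis
    using rank_sum_le_repair_bandwidth[OF F \<open>\<alpha> \<in> A\<close> ind \<beta>] by linarith
qed

text \<open>The tangent line of the exponential, at the two consecutive integers around the mean.\<close>

lemma rank_tangent_bound:
  fixes N R l k d :: nat
  assumes "2 ^ l \<le> N * 2 ^ R" and "l + 1 = k + d"
  shows "2 ^ k * (int d - int R) \<le> int N"
proof (cases "R < d")
  case True
  then have "l = k + (d - 1 - R) + R"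
    using assms(2) by linarith
  then have "(2::nat) ^ l = 2 ^ k * 2 ^ (d - 1 - R) * 2 ^ R"
    by (simp only: power_add)
  then have "2 ^ k * 2 ^ (d - 1 - R) * 2 ^ R \<le> N * 2 ^ R"
    using assms(1) by simp
  then have N: "2 ^ k * 2 ^ (d - 1 - R) \<le> N"
    by (rule mult_right_le_imp_le) simp
  \<comment> \<open>With \<open>n = d - 1 - R\<close> this is \<open>n + 1 \<le> 2 ^ n\<close>, an
    equality exactly for \<open>n = 0\<close> and \<open>n = 1\<close>.\<close>
  have "d - R \<le> 2 ^ (d - 1 - R)"
    using True less_exp[of "d - 1 - R"] by linarith
  then have "2 ^ k * (d - R) \<le> N"
    by (rule order_trans[OF mult_le_mono2 N])
  then have "int (2 ^ k * (d - R)) \<le> int N"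
    by (simp only: of_nat_le_iff)
  then show ?thesis
    using True by (simp add: of_nat_diff)
next
  case False
  then have "2 ^ k * (int d - int R) \<le> 0"
    by (simp add: mult_nonneg_nonpos)
  then show ?thesis
    by linarith
qed

text \<open>Sums \<open>rank_tangent_bound\<close> over the surviving nodes and caps the root counts
  by \<open>sum_card_roots_le\<close>.\<close>

lemma repair_bandwidth_counting_bound:
  fixes g :: "'l::finite \<Rightarrow> 'f::finite_field poly"
  assumes F: "CARD('f) = 2 ^ CARD('l)" and A: "card A = 2 ^ d" "\<alpha> \<in> A"
    and ind: "bindep_family (\<lambda>j. poly (g j) \<alpha>)" and deg: "\<And>j. degree (g j) \<le> 2" and \<beta>: "bbasis \<beta>"
    and k: "CARD('l) + 1 = k + d"
  shows "2 ^ k * ((2 ^ d - 1) * int d - repair_bandwidth A g \<beta>)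
    \<le> 2 ^ d - 1 + 2 * 2 ^ CARD('l) - 2 * int (card {u. degree (comb_poly g u) = 0})"
proof -
  let ?N = "\<lambda>x. card {u. poly (comb_poly g u) x = 0}"
  let ?R = "\<lambda>x. rank (repair_matrix g \<beta> x)"
  let ?C = "card {u. degree (comb_poly g u) = 0}"
  have card: "int (card (A - {\<alpha>})) = 2 ^ d - 1"
    using A by (simp add: of_nat_diff)
  have "2 ^ k * ((2 ^ d - 1) * int d - repair_bandwidth A g \<beta>)
      \<le> 2 ^ k * ((2 ^ d - 1) * int d - int (\<Sum>x\<in>A - {\<alpha>}. ?R x))"
    using rank_sum_le_repair_bandwidth[OF F A(2) ind \<beta>] by (intro mult_left_mono) auto
  also have "\<dots> = (\<Sum>x\<in>A - {\<alpha>}. 2 ^ k * (int d - int (?R x)))"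
    unfolding sum_distrib_left[symmetric] sum_subtractf sum_constant card by simp
  also have "\<dots> \<le> (\<Sum>x\<in>A - {\<alpha>}. int (?N x))"
    by (intro sum_mono rank_tangent_bound[OF card_roots_ge_rank[OF F \<beta>] k])
  also have "\<dots> \<le> 2 ^ d - 1 + 2 * 2 ^ CARD('l) - 2 * int ?C"
  proof -
    have "int ((\<Sum>x\<in>A - {\<alpha>}. ?N x) + 2 * ?C) \<le> int ((card A - 1) + 2 * 2 ^ CARD('l))"
      using sum_card_roots_le[OF F A(2) ind deg] by (simp only: of_nat_le_iff)
    then have "int (\<Sum>x\<in>A - {\<alpha>}. ?N x) + 2 * int ?C \<le> int (card A - 1) + 2 * 2 ^ CARD('l)"
      by (simp only: of_nat_add of_nat_mult of_nat_power of_nat_numeral)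
    moreover have "int (card A - 1) = 2 ^ d - 1"
      by (simp add: A(1) of_nat_diff)
    ultimately show ?thesis
      unfolding of_nat_sum by linarith
  qed
  finally show ?thesis .
qed

section \<open>Assembly of the bound\<close>

lemma floor_two_powi_neg:
  assumes "k < 0"
  shows "\<lfloor>(2 :: real) powi k\<rfloor> = 0"
proof -
  have "(2 :: real) powi k = inverse (2 ^ nat (- k))"
    using assms by (simp add: power_int_def power_one_over inverse_eq_divide)
  moreover have "inverse ((2::real) ^ nat (- k)) < 1"
    using assms by (subst inverse_less_1_iff) auto
  ultimately show ?thesis
    by (simp add: floor_eq_iff)
qed

theorem theorem19:
  fixes A :: "'f::finite_field set"
    and \<alpha> :: 'f
    and g :: "'l::finite \<Rightarrow> 'f poly"
    and \<beta> :: "'l \<Rightarrow> 'f"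
    and l d n :: nat
  assumes "l = CARD('l)"
    and "l > 1"
    and "CARD('f) = 2 ^ l"
    and "bsubspace A"
    and "bdim A = d"
    and "d = l \<or> (d < l \<and> (l - d + 2) dvd l)"
    and "n = 2 ^ d"
    and "io_optimal_scheme A \<alpha> g"
    and "bbasis \<beta>"
  shows "real_of_int (repair_bandwidth A g \<beta>) \<ge>
    (real n - 1) * (real d - 1) - 2 powi (2 * int d - int l - 1)
      + real_of_int \<lfloor>(2 :: real) powi (3 * int d - 2 * int l - 4)\<rfloor>"
proof -
  have F: "CARD('f) = 2 ^ CARD('l)"
    using assms(1,3) by simp
  define m where "m = l - d + 2"
  have dl: "d \<le> l" and m_dvd: "d < l \<Longrightarrow> m dvd l"
    using assms(6) by (auto simp: m_def)
  have md: "m + d = CARD('l) + 2"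
    using dl assms(1) by (simp add: m_def)
  \<comment> \<open>For \<open>d < l\<close>, divisibility gives \<open>m \<le> l\<close>, which
    says \<open>2 \<le> d\<close>.\<close>
  have d2: "2 \<le> d"
  proof (cases "d = l")
    case False
    then have "m dvd l"
      using dl m_dvd by simp
    then have "m \<le> l"
      using assms(2) by (intro dvd_imp_le) auto
    then show ?thesis
      using dl unfolding m_def by linarith
  qed (use assms(2) in simp)
  have A: "finite_subgroup A" "card A = 2 ^ d"
    using assms(4,5) card_bsubspace[OF F] by (simp_all add: finite_subgroup_bsubspace[OF F])
  have pow_d: "(4::nat) \<le> 2 ^ d"
    using power_increasing[OF d2, of "2::nat"] by simp
  \<comment> \<open>The basis \<open>\<beta>'\<close> witnessing optimality may differ from
    \<open>\<beta>\<close>: zero columns are counted with \<open>\<beta>'\<close>, ranks with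
    \<open>\<beta>\<close>.\<close>
  obtain \<beta>' where \<beta>': "bbasis \<beta>'" and io: "io_cost A g \<beta>' =
      (2 ^ d - 1) * int CARD('l) - (int CARD('l) - int d + 2) * 2 ^ (d - 1)"
    using assms(5,8) by (auto simp: io_optimal_scheme_def)
  have "linear_repair_scheme A (2 ^ d - 3) \<alpha> g"
    using assms(5,8) by (simp add: io_optimal_scheme_def)
  then have \<alpha>: "\<alpha> \<in> A" and ind: "bindep_family (\<lambda>j. poly (g j) \<alpha>)"
    and "\<And>j. degree (g j) < 2 ^ d - (2 ^ d - 3)"
    by (auto simp: linear_repair_scheme_def A)
  moreover have "(2::nat) ^ d - (2 ^ d - 3) = 3"
    using pow_d by linarith
  ultimately have deg: "degree (g j) \<le> 2" for j
    by (metis less_Suc_eq_le numeral_3_eq_3 numeral_2_eq_2)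
  define b where "b = repair_bandwidth A g \<beta>"
  have b_l: "int l \<le> b"
    using repair_bandwidth_ge_length[OF F \<alpha> _ ind deg assms(9)] pow_d
    by (simp add: A b_def assms(1))
  show ?thesis
  proof (cases "d = 2")
    \<comment> \<open>The target is now \<open>3 - 2 powi (3 - l)\<close>, which is 1 for
      \<open>l = 2\<close> and below 3 otherwise, so \<open>b \<ge> l\<close> suffices.\<close>
    case True
    have "\<lfloor>(2 :: real) powi (3 * int d - 2 * int l - 4)\<rfloor> = 0"
      using True assms(2) by (intro floor_two_powi_neg) simp
    moreover have "real_of_int b \<ge> 3 - 2 powi (3 - int l)"
    proof (cases "l = 2")
      case False
      then have "b \<ge> 3"
        using b_l assms(2) by linarith
      moreover have "(2 :: real) powi (3 - int l) > 0"
        by simp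
      ultimately show ?thesis
        by linarith
    qed (use b_l in simp)
    ultimately show ?thesis
      using True assms(7) by (simp add: b_def)
  next
    case False
    \<comment> \<open>The quotient of \<open>l\<close> by \<open>m\<close> is not 1, as
      \<open>l = m\<close> would mean \<open>d = 2\<close>. Thus \<open>2 * m \<le> l\<close>, and
      the first exponent in the claim is nonnegative.\<close>
    have e_nonneg: "l + 1 \<le> 2 * d"
    proof (cases "d = l")
      case False
      then obtain c where c: "l = m * c"
        using dl m_dvd by auto
      have "c \<noteq> 0"
        using c assms(2) by (cases "c = 0") simp_all
      moreover have "c \<noteq> 1"
        using c dl d2 \<open>d \<noteq> 2\<close> by (cases "c = 1") (simp_all add: m_def)
      ultimately have "2 \<le> c"
        by linarith
      then have "m * 2 \<le> m * c"
        by (rule mult_le_mono2)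
      then have "m * 2 \<le> l"
        using c by simp
      then show ?thesis
        using md assms(1) by linarith
    qed (use assms(2) in simp)
    define e where "e = 2 * d - l - 1"
    define k where "k = m - 1"
    let ?C = "card {u. degree (comb_poly g u) = 0}"
    have k: "CARD('l) + 1 = k + d"
      using md by (simp add: k_def m_def)
    have de: "d = k + e" and l1: "l + 1 = k + d"
      using k e_nonneg dl by (simp_all add: e_def k_def m_def assms(1))
    \<comment> \<open>The target without its floor term, minus \<open>b\<close>; the claim is that
      \<open>X\<close> plus the floor is at most 0.\<close>
    define X where "X = (2 ^ d - 1) * (int d - 1) - 2 ^ e - b"
    have pow: "(2::int) ^ d = 2 ^ k * 2 ^ e" "2 * (2::int) ^ CARD('l) = 2 ^ k * 2 ^ d"
      using de l1 assms(1) by (simp_all flip: power_add power_Suc)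
    have "2 ^ k * ((2 ^ d - 1) * int d - b) \<le> 2 ^ d - 1 + 2 * 2 ^ CARD('l) - 2 * int ?C"
      unfolding b_def by (rule repair_bandwidth_counting_bound[OF F A(2) \<alpha> ind deg assms(9) k])
    moreover have "2 ^ k * ((2 ^ d - 1) * int d - b) =
        2 ^ k * (X - 1) + 2 ^ k * 2 ^ e + 2 ^ k * 2 ^ d"
      by (simp add: X_def algebra_simps)
    ultimately have X: "2 ^ k * (X - 1) \<le> - 1 - 2 * int ?C"
      using pow by linarith
    have powi_e: "(2::real) powi (2 * int d - int l - 1) = 2 ^ e"
    proof -
      have "2 * int d - int l - 1 = int e"
        using e_nonneg by (simp add: e_def of_nat_diff)
      then show ?thesis
        by simp
    qed
    have concl: ?thesis if "X + \<lfloor>(2 :: real) powi (3 * int d - 2 * int l - 4)\<rfloor> \<le> 0"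
    proof -
      have "real_of_int (X + \<lfloor>(2 :: real) powi (3 * int d - 2 * int l - 4)\<rfloor>) \<le> 0"
        using that by (simp only: of_int_le_0_iff)
      then show ?thesis
        by (simp add: X_def powi_e b_def assms(7))
    qed
    show ?thesis
    proof (cases "3 * int d - 2 * int l - 4 < 0")
      \<comment> \<open>The floor is zero, and the \<open>- 1\<close> in \<open>X\<close> already
        forces \<open>X \<le> 0\<close> by integrality.\<close>
      case True
      have "X - 1 < 0"
      proof (rule ccontr)
        assume "\<not> X - 1 < 0"
        then have "0 \<le> 2 ^ k * (X - 1)"
          by simp
        then show False
          using X by linarith
      qed
      then show ?thesis
        using True by (intro concl) (simp add: floor_two_powi_neg)
    next
      case False
      define f where "f = 3 * d - 2 * l - 4"
      have f: "3 * int d - 2 * int l - 4 = int f"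
        using False by (simp add: f_def of_nat_diff)
      have "2 ^ CARD('l) \<le> ?C * 2 ^ (2 * m)"
      proof (rule card_constant_combs[OF F A \<alpha> ind deg \<beta>' _ md])
        have "int (\<Sum>s\<in>UNIV. card (zero_nodes A g (\<beta>' s))) = (int CARD('l) - int d + 2) * 2 ^ (d - 1)"
          using io_cost_eq_zero_nodes[OF F, of A g \<beta>'] io by (simp add: A(2))
        also have "int CARD('l) - int d + 2 = int m"
          using md by linarith
        finally have "int (\<Sum>s\<in>UNIV. card (zero_nodes A g (\<beta>' s))) = int (m * 2 ^ (d - 1))"
          by simp
        then show "(\<Sum>s\<in>UNIV. card (zero_nodes A g (\<beta>' s))) = m * 2 ^ (d - 1)"
          by (simp only: of_nat_eq_iff)
      qed (use d2 in simp)
      \<comment> \<open>This identity turns the count of constants into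
        \<open>2 ^ (k + f) \<le> 2 * ?C\<close>.\<close>
      moreover have "CARD('l) + 1 = (k + f) + 2 * m"
        using False dl by (simp add: k_def f_def m_def assms(1)[symmetric])
      then have "2 * 2 ^ CARD('l) = (2::nat) ^ (k + f) * 2 ^ (2 * m)"
        by (simp flip: power_add power_Suc)
      ultimately have "2 ^ (k + f) * 2 ^ (2 * m) \<le> (2 * ?C) * 2 ^ (2 * m)"
        by linarith
      then have "2 ^ (k + f) \<le> 2 * ?C"
        by (rule mult_right_le_imp_le) simp
      then have "int (2 ^ (k + f)) \<le> int (2 * ?C)"
        by (simp only: of_nat_le_iff)
      then have "2 ^ k * (X - 1 + 2 ^ f) \<le> - 1"
        using X by (simp add: power_add distrib_left)
      \<comment> \<open>Integrality then yields \<open>X + 2 ^ f \<le> 0\<close>.\<close>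
      then have "X - 1 + 2 ^ f < 0"
        by (smt (verit) mult_nonneg_nonneg zero_le_power)
      then show ?thesis
        by (intro concl) (simp add: f)
    qed
  qed
qed

end
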